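(* Let $N$ be one of the following matroids: $U_{2,k}$ for some integer $k\ge 2$, $U_{3,6}$, $P_6$, $Q_6$ or $R_6$. Let $\mathrm{Ex}(N)$ be the class of matroids without a minor isomorphic to $N$, and $\mathbb{M}_n$ the set of matroids with ground set $[n]=\{1,\dots,n\}$. Then $$\log_2 |\mathrm{Ex}(N)\cap \mathbb{M}_n| \le O\!\left(\frac{2^n}{n^{5/2}}\log^2(n)\right) \quad\text{as } n\to\infty.$$
   Context: $U_{r,m}$ is the uniform matroid of rank $r$ on $m$ elements. $P_6$, $Q_6$, $R_6$ are simple rank-3 matroids on $\{a,b,c,d,e,f\}$ in which the dependent 3-sets are exactly: for $P_6$, $\{a,b,c\}$ only; for $Q_6$, $\{a,b,c\}$ and $\{a,d,e\}$; for $R_6$, $\{a,b,c\}$ and $\{d,e,f\}$. Logarithms are base 2. *)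

theory Defs
  imports Complex_Main "HOL-Library.Landau_Symbols"
begin

text \<open>
  A matroid is a pair of a finite ground set and its family of independent sets. The family is
  required to consist of subsets of the ground set, so equality of pairs is equality of (labelled)
  matroids.
\<close>

type_synonym 'a set_system = "'a set \<times> 'a set set"

abbreviation ground :: "'a set_system \<Rightarrow> 'a set" where "ground \<equiv> fst"

abbreviation indeps :: "'a set_system \<Rightarrow> 'a set set" where "indeps \<equiv> snd"

definition matroid :: "'a set_system \<Rightarrow> bool" where
  "matroid M \<longleftrightarrow>
     finite (ground M) \<and>
     indeps M \<subseteq> Pow (ground M) \<and>
     {} \<in> indeps M \<and>
     (\<forall>X Y. Y \<in> indeps M \<and> X \<subseteq> Y \<longrightarrow> X \<in> indeps M) \<and>
     (\<forall>X Y. X \<in> indeps M \<and> Y \<in> indeps M \<and> card X < card Y \<longrightarrow>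
        (\<exists>e\<in>Y - X. insert e X \<in> indeps M))"

definition matroid_rank :: "'a set_system \<Rightarrow> nat" where
  "matroid_rank M = Max (card ` indeps M)"

text \<open>No loops and no parallel pairs.\<close>

definition simple_matroid :: "'a set_system \<Rightarrow> bool" where
  "simple_matroid M \<longleftrightarrow> (\<forall>X \<subseteq> ground M. card X \<le> 2 \<longrightarrow> X \<in> indeps M)"

definition basis_of :: "'a set_system \<Rightarrow> 'a set \<Rightarrow> 'a set \<Rightarrow> bool" where
  "basis_of M A B \<longleftrightarrow> B \<in> indeps M \<and> B \<subseteq> A \<and>
     (\<forall>B'. B' \<in> indeps M \<and> B \<subseteq> B' \<and> B' \<subseteq> A \<longrightarrow> B' = B)"

definition delete :: "'a set_system \<Rightarrow> 'a set \<Rightarrow> 'a set_system" where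
  "delete M D = (ground M - D, {X \<in> indeps M. X \<inter> D = {}})"

text \<open>
  The independent sets of \<open>M / C\<close> are those \<open>X\<close> disjoint from \<open>C\<close> for which \<open>X \<union> B\<close> is
  independent in \<open>M\<close>, where \<open>B\<close> is a maximal independent subset of \<open>C\<close>. In a matroid the choice
  of \<open>B\<close> is immaterial; see \<open>contract_basis_irrelevant\<close> below.
\<close>

definition contract :: "'a set_system \<Rightarrow> 'a set \<Rightarrow> 'a set_system" where
  "contract M C =
     (ground M - C, {X. X \<subseteq> ground M - C \<and> (\<exists>B. basis_of M C B \<and> X \<union> B \<in> indeps M)})"

definition is_minor :: "'a set_system \<Rightarrow> 'a set_system \<Rightarrow> bool" where
  "is_minor N M \<longleftrightarrow> (\<exists>C D. C \<subseteq> ground M \<and> D \<subseteq> ground M \<and> C \<inter> D = {} \<and>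
     N = delete (contract M C) D)"

definition isomorphic :: "'a set_system \<Rightarrow> 'b set_system \<Rightarrow> bool" where
  "isomorphic M N \<longleftrightarrow> (\<exists>f. bij_betw f (ground M) (ground N) \<and>
     (\<forall>X \<subseteq> ground M. X \<in> indeps M \<longleftrightarrow> f ` X \<in> indeps N))"

definition excluding :: "'b set_system \<Rightarrow> 'a set_system set" where
  "excluding N = {M. matroid M \<and> \<not> (\<exists>M'. is_minor M' M \<and> isomorphic M' N)}"

definition matroids_on :: "nat \<Rightarrow> nat set_system set" where
  "matroids_on n = {M. matroid M \<and> ground M = {1..n}}"

definition uniform_matroid :: "nat \<Rightarrow> nat \<Rightarrow> nat set_system" where
  "uniform_matroid r m = ({1..m}, {X. X \<subseteq> {1..m} \<and> card X \<le> r})"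

text \<open>
  The elements \<open>a, \<dots>, f\<close> are encoded as \<open>1, \<dots>, 6\<close>. The argument \<open>L\<close> is the set of dependent
  3-sets; see \<open>rank3_on_six_unique\<close> and the lemmas following it.
\<close>

definition rank3_on_six :: "nat set set \<Rightarrow> nat set_system" where
  "rank3_on_six L = ({1..6}, {X. X \<subseteq> {1..6} \<and> card X \<le> 3 \<and> X \<notin> L})"

definition P6 :: "nat set_system" where
  "P6 = rank3_on_six {{1,2,3}}"

definition Q6 :: "nat set_system" where
  "Q6 = rank3_on_six {{1,2,3}, {1,4,5}}"

definition R6 :: "nat set_system" where
  "R6 = rank3_on_six {{1,2,3}, {4,5,6}}"


lemma matroidI:
  assumes "finite E" "\<And>X. X \<in> I \<Longrightarrow> X \<subseteq> E" "{} \<in> I"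
    and "\<And>X Y. Y \<in> I \<Longrightarrow> X \<subseteq> Y \<Longrightarrow> X \<in> I"
    and "\<And>X Y. X \<in> I \<Longrightarrow> Y \<in> I \<Longrightarrow> card X < card Y \<Longrightarrow> \<exists>e\<in>Y - X. insert e X \<in> I"
  shows "matroid (E, I)"
  unfolding matroid_def fst_conv snd_conv
proof (intro conjI allI impI)
  show "I \<subseteq> Pow E" using assms(2) by blast
qed (rule assms(1), rule assms(3), metis assms(4), metis assms(5))

lemma finite_matroids_on: "finite (matroids_on n)"
proof (rule finite_subset)
  show "matroids_on n \<subseteq> {{1..n}} \<times> Pow (Pow {1..n})"
  proof
    fix M assume "M \<in> matroids_on n"
    then have "ground M = {1..n}" "indeps M \<subseteq> Pow (ground M)"
      unfolding matroids_on_def matroid_def by blast+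
    then show "M \<in> {{1..n}} \<times> Pow (Pow {1..n})"
      unfolding mem_Times_iff by (metis PowI singletonI)
  qed
qed (intro finite_SigmaI finite.intros; simp)

lemma matroid_finite_indep: "matroid M \<Longrightarrow> X \<in> indeps M \<Longrightarrow> finite X"
  unfolding matroid_def by (meson PowD finite_subset in_mono)

lemma basis_of_card_le:
  assumes M: "matroid M" and B: "basis_of M A B" and X: "X \<in> indeps M" "X \<subseteq> A"
  shows "card X \<le> card B"
proof (rule ccontr)
  assume "\<not> card X \<le> card B"
  then obtain e where e: "e \<in> X - B" "insert e B \<in> indeps M"
    using M B X unfolding matroid_def basis_of_def by (metis not_le)
  then have "insert e B = B"
    using B X unfolding basis_of_def by (metis DiffD1 insert_subset subset_iff subset_insertI)
  with e show False by auto
qed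

lemma basis_of_exists:
  assumes M: "matroid M"
  shows "\<exists>B. basis_of M A B"
proof -
  let ?S = "{B \<in> indeps M. B \<subseteq> A}"
  have "finite (indeps M)"
    using M unfolding matroid_def by (meson finite_Pow_iff finite_subset)
  then have "finite ?S" by simp
  moreover have "{} \<in> ?S" using M by (auto simp: matroid_def)
  ultimately obtain B where "B \<in> ?S" "\<And>B'. B' \<in> ?S \<Longrightarrow> B \<subseteq> B' \<Longrightarrow> B' = B"
    by (metis (no_types, lifting) finite_has_maximal2)
  then show ?thesis by (auto simp: basis_of_def)
qed

lemma augment_over_basis:
  assumes M: "matroid M" and B: "basis_of M C B" and B': "basis_of M C B'"
    and XB: "X \<union> B \<in> indeps M" and YB: "Y \<union> B' \<in> indeps M"
    and disj: "X \<inter> C = {}" "Y \<inter> C = {}" and less: "card X < card Y"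
  shows "\<exists>e\<in>Y - X. insert e X \<union> B \<in> indeps M"
proof -
  have fin: "finite (X \<union> B)" "finite (Y \<union> B')"
    using matroid_finite_indep[OF M] XB YB by auto
  have "card B = card B'"
    using basis_of_card_le[OF M B, of B'] basis_of_card_le[OF M B', of B] B B'
    by (auto simp: basis_of_def)
  moreover have "card (X \<union> B) = card X + card B" "card (Y \<union> B') = card Y + card B'"
    using fin disj B B' by (auto simp: basis_of_def intro!: card_Un_disjoint)
  ultimately have "card (X \<union> B) < card (Y \<union> B')" using less by simp
  then obtain e where e: "e \<in> (Y \<union> B') - (X \<union> B)" "insert e (X \<union> B) \<in> indeps M"
    using M XB YB unfolding matroid_def by metis
  have "e \<notin> B'"
  proof
    assume "e \<in> B'"
    moreover have "insert e B \<in> indeps M"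
      using M e(2) unfolding matroid_def by (metis insert_mono sup_ge2)
    ultimately have "insert e B = B"
      using B B' unfolding basis_of_def by (metis insert_subset subset_iff subset_insertI)
    with e(1) show False by auto
  qed
  with e show ?thesis by auto
qed

lemma contract_basis_irrelevant:
  assumes M: "matroid M" and B: "basis_of M C B" and B': "basis_of M C B'"
    and X: "X \<inter> C = {}" and XB: "X \<union> B \<in> indeps M"
  shows "X \<union> B' \<in> indeps M"
proof -
  have fin: "finite X" using matroid_finite_indep[OF M XB] by simp
  have "B' \<in> indeps M" using B' by (simp add: basis_of_def)
  have "\<exists>Z \<subseteq> X. card Z = n \<and> Z \<union> B' \<in> indeps M" if "n \<le> card X" for n
    using that
  proof (induction n)
    case 0
    then show ?case using \<open>B' \<in> indeps M\<close> by (intro exI[of _ "{}"]) auto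
  next
    case (Suc n)
    then obtain Z where Z: "Z \<subseteq> X" "card Z = n" "Z \<union> B' \<in> indeps M" by auto
    obtain e where "e \<in> X - Z" "insert e Z \<union> B' \<in> indeps M"
      using augment_over_basis[OF M B' B Z(3) XB] Z X Suc.prems by auto
    with Z fin show ?case
      by (intro exI[of _ "insert e Z"]) (auto simp: finite_subset card_insert_if)
  qed
  then obtain Z where "Z \<subseteq> X" "card Z = card X" "Z \<union> B' \<in> indeps M" by blast
  with fin show ?thesis by (metis card_subset_eq)
qed

lemma matroid_delete:
  assumes M: "matroid M"
  shows "matroid (delete M D)"
  unfolding delete_def
proof (rule matroidI)
  show "finite (ground M - D)" using M unfolding matroid_def by (metis finite_Diff)
  have "{} \<in> indeps M" using M unfolding matroid_def by metis
  then show "{} \<in> {X \<in> indeps M. X \<inter> D = {}}" by simp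
next
  fix X assume "X \<in> {X \<in> indeps M. X \<inter> D = {}}"
  moreover have "indeps M \<subseteq> Pow (ground M)" using M unfolding matroid_def by metis
  ultimately show "X \<subseteq> ground M - D" by blast
next
  fix X Y assume Y: "Y \<in> {X \<in> indeps M. X \<inter> D = {}}" and XY: "X \<subseteq> Y"
  then have "X \<in> indeps M" using M unfolding matroid_def mem_Collect_eq by metis
  with Y XY show "X \<in> {X \<in> indeps M. X \<inter> D = {}}" by blast
next
  fix X Y assume X: "X \<in> {X \<in> indeps M. X \<inter> D = {}}" and Y: "Y \<in> {X \<in> indeps M. X \<inter> D = {}}"
    and "card X < card Y"
  then obtain e where "e \<in> Y - X" "insert e X \<in> indeps M"
    using M unfolding matroid_def mem_Collect_eq by metis
  with X Y show "\<exists>e\<in>Y - X. insert e X \<in> {X \<in> indeps M. X \<inter> D = {}}" by blast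
qed

lemma matroid_contract:
  assumes M: "matroid M"
  shows "matroid (contract M C)"
proof -
  define I where "I = indeps (contract M C)"
  have I_iff: "X \<in> I \<longleftrightarrow> X \<subseteq> ground M - C \<and> (\<exists>B. basis_of M C B \<and> X \<union> B \<in> indeps M)" for X
    unfolding I_def contract_def by simp
  have "matroid (ground M - C, I)"
  proof (rule matroidI)
    show "finite (ground M - C)" using M unfolding matroid_def by (metis finite_Diff)
  next
    fix X assume "X \<in> I"
    then show "X \<subseteq> ground M - C" unfolding I_iff by (rule conjunct1)
  next
    obtain B where B: "basis_of M C B" using basis_of_exists[OF M] by metis
    then have "{} \<union> B \<in> indeps M" unfolding basis_of_def Un_empty_left by (rule conjunct1)
    with B show "{} \<in> I" unfolding I_iff by (metis empty_subsetI)
  next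
    fix X Y assume "Y \<in> I" and XY: "X \<subseteq> Y"
    then obtain B where B: "Y \<subseteq> ground M - C" "basis_of M C B" "Y \<union> B \<in> indeps M"
      unfolding I_iff by metis
    have "X \<union> B \<subseteq> Y \<union> B" using XY by (rule Un_mono) (rule order_refl)
    then have "X \<union> B \<in> indeps M" using M B(3) unfolding matroid_def by metis
    with B XY show "X \<in> I" unfolding I_iff by (metis order_trans)
  next
    fix X Y assume "X \<in> I" "Y \<in> I" and less: "card X < card Y"
    then obtain B B' where B: "basis_of M C B" "basis_of M C B'" "X \<union> B \<in> indeps M"
        "Y \<union> B' \<in> indeps M" and sub: "X \<subseteq> ground M - C" "Y \<subseteq> ground M - C"
      unfolding I_iff by metis
    have "X \<inter> C = {}" "Y \<inter> C = {}" using sub by fast+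
    then obtain e where e: "e \<in> Y - X" "insert e X \<union> B \<in> indeps M"
      using augment_over_basis[OF M B] less by metis
    moreover have "insert e X \<subseteq> ground M - C" using e(1) sub by fast
    ultimately show "\<exists>e\<in>Y - X. insert e X \<in> I" using B(1) unfolding I_iff by metis
  qed
  then show ?thesis by (simp add: I_def contract_def)
qed

lemma matroid_is_minor: "matroid M \<Longrightarrow> is_minor N M \<Longrightarrow> matroid N"
  unfolding is_minor_def using matroid_delete matroid_contract by metis

lemma matroid_uniform: "matroid (uniform_matroid r m)"
proof -
  have fin: "finite X" if "X \<subseteq> {1..m}" for X :: "nat set"
    using that finite_subset by blast
  have aug: "\<exists>e\<in>Y - X. insert e X \<subseteq> {1..m} \<and> card (insert e X) \<le> r"
    if "X \<subseteq> {1..m}" "Y \<subseteq> {1..m}" "card Y \<le> r" "card X < card Y" for X Y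
  proof -
    have "\<not> Y \<subseteq> X" using that fin[OF that(1)] by (meson card_mono not_le)
    then obtain e where "e \<in> Y - X" by auto
    with that fin[OF that(1)] show ?thesis by (intro bexI[of _ e]) auto
  qed
  show ?thesis
    unfolding uniform_matroid_def
  proof (rule matroidI)
    fix X Y assume "Y \<in> {X. X \<subseteq> {1..m} \<and> card X \<le> r}" "X \<subseteq> Y"
    then show "X \<in> {X. X \<subseteq> {1..m} \<and> card X \<le> r}"
      unfolding mem_Collect_eq by (metis card_mono fin order_trans)
  next
    fix X Y assume "X \<in> {X. X \<subseteq> {1..m} \<and> card X \<le> r}" "Y \<in> {X. X \<subseteq> {1..m} \<and> card X \<le> r}" "card X < card Y"
    then show "\<exists>e\<in>Y - X. insert e X \<in> {X. X \<subseteq> {1..m} \<and> card X \<le> r}"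
      unfolding mem_Collect_eq by (metis aug)
  qed (simp, blast, simp)
qed

lemma matroid_rank3_on_six:
  assumes L: "\<And>X. X \<in> L \<Longrightarrow> card X = 3"
    and meet: "\<And>X Y. X \<in> L \<Longrightarrow> Y \<in> L \<Longrightarrow> X \<noteq> Y \<Longrightarrow> card (X \<inter> Y) \<le> 1"
  shows "matroid (rank3_on_six L)"
proof -
  have fin: "finite X" if "X \<subseteq> {1..6}" for X :: "nat set"
    using that finite_subset by blast
  have aug: "\<exists>e\<in>Y - X. insert e X \<subseteq> {1..6} \<and> card (insert e X) \<le> 3 \<and> insert e X \<notin> L"
    if X: "X \<subseteq> {1..6}" and Y: "Y \<subseteq> {1..6}" "card Y \<le> 3" "Y \<notin> L" and less: "card X < card Y"
    for X Y
  proof (rule ccontr)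
    assume contra: "\<not> ?thesis"
    note finX = fin[OF X] and finY = fin[OF Y(1)]
    have *: "card X = 2 \<and> insert e X \<in> L" if "e \<in> Y - X" for e
    proof -
      have "card (insert e X) \<le> 3" "card (insert e X) = Suc (card X)"
        using that finX less Y by auto
      moreover have "insert e X \<in> L" using contra that X Y calculation by blast
      ultimately show ?thesis using L by fastforce
    qed
    have "\<not> Y \<subseteq> X" using less finX by (meson card_mono not_le)
    then obtain e where e: "e \<in> Y - X" by auto
    have "Y \<noteq> insert e X" using * e Y by auto
    moreover have "card (insert e X) = card Y" using * e less Y finX by auto
    ultimately have "\<not> Y \<subseteq> insert e X" using finX by (metis card_subset_eq finite_insert)
    then obtain f where f: "f \<in> Y - X" "f \<noteq> e" by auto
    have "insert e X \<inter> insert f X = X" "insert e X \<noteq> insert f X" using e f by auto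
    then show False using meet[of "insert e X" "insert f X"] * e f by fastforce
  qed
  have mono: "card X \<le> 3 \<and> X \<notin> L" if "Y \<subseteq> {1..6}" "card Y \<le> 3" "Y \<notin> L" "X \<subseteq> Y" for X Y
    using that fin L by (metis card_mono card_subset_eq le_antisym le_trans)
  have "{} \<notin> L" using L by fastforce
  show ?thesis
    unfolding rank3_on_six_def
  proof (rule matroidI)
    show "{} \<in> {X. X \<subseteq> {1..6} \<and> card X \<le> 3 \<and> X \<notin> L}" using \<open>{} \<notin> L\<close> by simp
  next
    fix X Y assume "Y \<in> {X. X \<subseteq> {1..6} \<and> card X \<le> 3 \<and> X \<notin> L}" "X \<subseteq> Y"
    then show "X \<in> {X. X \<subseteq> {1..6} \<and> card X \<le> 3 \<and> X \<notin> L}"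
      unfolding mem_Collect_eq by (metis mono order_trans)
  next
    fix X Y assume "X \<in> {X. X \<subseteq> {1..6} \<and> card X \<le> 3 \<and> X \<notin> L}"
      "Y \<in> {X. X \<subseteq> {1..6} \<and> card X \<le> 3 \<and> X \<notin> L}" "card X < card Y"
    then show "\<exists>e\<in>Y - X. insert e X \<in> {X. X \<subseteq> {1..6} \<and> card X \<le> 3 \<and> X \<notin> L}"
      unfolding mem_Collect_eq by (metis aug)
  qed (simp, blast)
qed

lemma rank3_on_six_unique:
  assumes M: "matroid M" "ground M = {1..6}" "simple_matroid M" "matroid_rank M = 3"
    and L: "{X. X \<subseteq> {1..6} \<and> card X = 3 \<and> X \<notin> indeps M} = L"
  shows "M = rank3_on_six L"
proof -
  have sub: "X \<subseteq> {1..6}" if "X \<in> indeps M" for X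
    using M that by (auto simp: matroid_def)
  have "finite (indeps M)"
    using M unfolding matroid_def by (meson finite_Pow_iff finite_subset)
  then have rk: "card X \<le> 3" if "X \<in> indeps M" for X
    using that M(4) unfolding matroid_rank_def by (metis Max_ge finite_imageI image_eqI)
  have "X \<in> indeps M" if "X \<subseteq> {1..6}" "card X \<le> 3" "X \<notin> L" for X
    using that L M(2,3) by (cases "card X = 3") (auto simp: simple_matroid_def)
  then have "indeps M = {X. X \<subseteq> {1..6} \<and> card X \<le> 3 \<and> X \<notin> L}"
    using sub rk L by auto
  then show ?thesis using M(2) by (simp add: rank3_on_six_def prod_eq_iff)
qed

lemma rank3_on_six_properties:
  assumes L: "\<And>X. X \<in> L \<Longrightarrow> X \<subseteq> {1..6} \<and> card X = 3" and "\<And>X. X \<in> L \<Longrightarrow> \<not> {1,2,4} \<subseteq> X"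
  shows "ground (rank3_on_six L) = {1..6}" "simple_matroid (rank3_on_six L)"
    "matroid_rank (rank3_on_six L) = 3"
    "{X. X \<subseteq> {1..6} \<and> card X = 3 \<and> X \<notin> indeps (rank3_on_six L)} = L"
proof -
  let ?I = "indeps (rank3_on_six L)"
  have "{1,2,4} \<in> ?I" using assms(2)[of "{1,2,4}"] by (auto simp: rank3_on_six_def)
  then have "3 \<in> card ` ?I" by (rule rev_image_eqI) simp
  moreover have "?I \<subseteq> Pow {1..6}" by (auto simp: rank3_on_six_def)
  then have "finite (card ` ?I)" by (meson finite_Pow_iff finite_atLeastAtMost finite_imageI finite_subset)
  ultimately show "matroid_rank (rank3_on_six L) = 3"
    unfolding matroid_rank_def by (intro Max_eqI) (auto simp: rank3_on_six_def)
  show "ground (rank3_on_six L) = {1..6}" by (simp add: rank3_on_six_def)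
  have "X \<notin> L" if "card X \<le> 2" for X using L that by fastforce
  then show "simple_matroid (rank3_on_six L)"
    by (simp add: simple_matroid_def rank3_on_six_def)
  show "{X. X \<subseteq> {1..6} \<and> card X = 3 \<and> X \<notin> indeps (rank3_on_six L)} = L"
    unfolding rank3_on_six_def snd_conv set_eq_iff mem_Collect_eq by (metis L order_refl)
qed

lemma matroid_P6: "matroid P6"
  unfolding P6_def by (rule matroid_rank3_on_six) auto

lemma matroid_Q6: "matroid Q6"
  unfolding Q6_def by (rule matroid_rank3_on_six) auto

lemma matroid_R6: "matroid R6"
  unfolding R6_def by (rule matroid_rank3_on_six) auto

lemma P6_properties:
  "ground P6 = {1..6}" "simple_matroid P6" "matroid_rank P6 = 3"
  "{X. X \<subseteq> {1..6} \<and> card X = 3 \<and> X \<notin> indeps P6} = {{1,2,3}}"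
proof -
  have L: "X \<subseteq> {1..6} \<and> card X = 3" "\<not> {1,2,4} \<subseteq> X" if "X \<in> {{1,2,3}}" for X :: "nat set"
    using that by (elim insertE emptyE; hypsubst; simp)+
  show "ground P6 = {1..6}" "simple_matroid P6" "matroid_rank P6 = 3"
    "{X. X \<subseteq> {1..6} \<and> card X = 3 \<and> X \<notin> indeps P6} = {{1,2,3}}"
    unfolding P6_def by (rule rank3_on_six_properties; erule L)+
qed

lemma Q6_properties:
  "ground Q6 = {1..6}" "simple_matroid Q6" "matroid_rank Q6 = 3"
  "{X. X \<subseteq> {1..6} \<and> card X = 3 \<and> X \<notin> indeps Q6} = {{1,2,3}, {1,4,5}}"
proof -
  have L: "X \<subseteq> {1..6} \<and> card X = 3" "\<not> {1,2,4} \<subseteq> X" if "X \<in> {{1,2,3}, {1,4,5}}" for X :: "nat set"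
    using that by (elim insertE emptyE; hypsubst; simp)+
  show "ground Q6 = {1..6}" "simple_matroid Q6" "matroid_rank Q6 = 3"
    "{X. X \<subseteq> {1..6} \<and> card X = 3 \<and> X \<notin> indeps Q6} = {{1,2,3}, {1,4,5}}"
    unfolding Q6_def by (rule rank3_on_six_properties; erule L)+
qed

lemma R6_properties:
  "ground R6 = {1..6}" "simple_matroid R6" "matroid_rank R6 = 3"
  "{X. X \<subseteq> {1..6} \<and> card X = 3 \<and> X \<notin> indeps R6} = {{1,2,3}, {4,5,6}}"
proof -
  have L: "X \<subseteq> {1..6} \<and> card X = 3" "\<not> {1,2,4} \<subseteq> X" if "X \<in> {{1,2,3}, {4,5,6}}" for X :: "nat set"
    using that by (elim insertE emptyE; hypsubst; simp)+
  show "ground R6 = {1..6}" "simple_matroid R6" "matroid_rank R6 = 3"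
    "{X. X \<subseteq> {1..6} \<and> card X = 3 \<and> X \<notin> indeps R6} = {{1,2,3}, {4,5,6}}"
    unfolding R6_def by (rule rank3_on_six_properties; erule L)+
qed

end

theory Submission
  imports Defs "HOL-Real_Asymp.Real_Asymp"
begin

text \<open>
  A matroid of rank \<open>r\<close> is determined by \<open>r\<close> and a flat cover: pairs \<open>(F, k)\<close> with
  \<open>rk F \<le> k\<close> such that each dependent \<open>r\<close>-set \<open>X\<close> satisfies \<open>\<bar>X \<inter> F\<bar> > k\<close> for one of them.
  Hence it suffices that every matroid in the class has a flat cover with
  \<open>O(2\<^sup>n log n / n\<^bsup>5/2\<^esup>)\<close> members.

  The dependent \<open>r\<close>-sets containing a fixed independent \<open>(r-3)\<close>-set \<open>S\<close> are governed by the
  rank-3 matroid \<open>M / S\<close>, and are covered by its loops, its parallel classes, and its lines with at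
  least three points. Excluding \<open>N\<close> makes the number of these lines linear in \<open>n\<close>: a configuration
  with many long lines has a restriction in which every point is on hundreds of three-point lines,
  and there \<open>U\<^bsub>3,6\<^esub>\<close>, \<open>P\<^sub>6\<close>, \<open>Q\<^sub>6\<close> and \<open>R\<^sub>6\<close> can all be found; for \<open>U\<^bsub>2,k\<^esub>\<close> contracting
  a point shows that it is on fewer than \<open>k\<close> lines. Finally, a greedy choice of
  \<open>O(2\<^sup>n log n / n\<^bsup>7/2\<^esup>)\<close> sets \<open>S\<close> leaves only \<open>O(2\<^sup>n / n\<^bsup>7/2\<^esup>)\<close> of the \<open>r\<close>-sets without a
  chosen subset, when \<open>r \<ge> n/4\<close>; for smaller \<open>r\<close> there are few \<open>r\<close>-sets altogether.
\<close>

section \<open>Partial linear spaces with many three-point lines\<close>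

text \<open>For points of a simple rank-3 matroid these are the dependent triples, hence the data
  that fix the isomorphism type of the restriction to \<open>S\<close>.\<close>

definition collinear_triples :: "'a set set \<Rightarrow> 'a set \<Rightarrow> 'a set set" where
  "collinear_triples \<L> S = {X. X \<subseteq> S \<and> card X = 3 \<and> (\<exists>L\<in>\<L>. X \<subseteq> L)}"

definition spanned_lines :: "'a set set \<Rightarrow> 'a set \<Rightarrow> 'a set set" where
  "spanned_lines \<L> S = {L \<in> \<L>. \<exists>x\<in>S \<inter> L. \<exists>y\<in>S \<inter> L. x \<noteq> y}"

text \<open>Two points lie on at most one line, possibly on none, so lines that become short after
  deleting points may be dropped from \<open>\<L>\<close>.\<close>

locale partial_linear_space =
  fixes Q :: "'a set" and \<L> :: "'a set set"
  assumes finite_points: "finite Q"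
    and line_subset: "L \<in> \<L> \<Longrightarrow> L \<subseteq> Q"
    and line_unique: "L \<in> \<L> \<Longrightarrow> L' \<in> \<L> \<Longrightarrow> x \<in> L \<inter> L' \<Longrightarrow> y \<in> L \<inter> L' \<Longrightarrow> x \<noteq> y \<Longrightarrow> L = L'"
begin

lemma finite_lines: "finite \<L>"
  using finite_points line_subset by (meson PowI finite_Pow_iff finite_subset subsetI)

lemma finite_line: "L \<in> \<L> \<Longrightarrow> finite L"
  using finite_points line_subset finite_subset by blast

lemma card_spanned_lines:
  assumes "finite S"
  shows "card (spanned_lines \<L> S) \<le> card S * card S"
proof -
  \<comment> \<open>On diagonal or unjoined pairs this description may be meaningless; only pairs of
    distinct points of \<open>S\<close> on a common line matter for reaching every spanned
    line.\<close>
  let ?g = "\<lambda>(x, y). THE L. L \<in> \<L> \<and> x \<in> L \<and> y \<in> L"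
  have "spanned_lines \<L> S \<subseteq> ?g ` (S \<times> S)"
  proof
    fix L assume "L \<in> spanned_lines \<L> S"
    then obtain x y where xy: "x \<in> S" "y \<in> S" "x \<in> L" "y \<in> L" "x \<noteq> y" "L \<in> \<L>"
      by (auto simp: spanned_lines_def)
    then have "(THE L. L \<in> \<L> \<and> x \<in> L \<and> y \<in> L) = L"
      using line_unique by (intro the_equality) blast+
    then have "L = ?g (x, y)" by simp
    then show "L \<in> ?g ` (S \<times> S)" by (rule image_eqI) (use xy in simp)
  qed
  then have "card (spanned_lines \<L> S) \<le> card (?g ` (S \<times> S))"
    using assms by (intro card_mono) auto
  also have "\<dots> \<le> card (S \<times> S)" using assms by (intro card_image_le) auto
  finally show ?thesis by (simp add: card_cartesian_product)
qed

text \<open>By pigeonhole a triple inside the union has two points in \<open>A\<close> or two in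
  \<open>B\<close>, so its line is that one. The case \<open>A = B\<close> is included and yields a
  single collinear triple.\<close>

lemma collinear_triples_eq_union:
  assumes "A \<union> B = S" "A \<in> \<L>" "B \<in> \<L>" "card A = 3" "card B = 3"
  shows "collinear_triples \<L> S = {A, B}"
proof
  show "{A, B} \<subseteq> collinear_triples \<L> S"
    using assms by (auto simp: collinear_triples_def)
  show "collinear_triples \<L> S \<subseteq> {A, B}"
  proof
    fix X assume "X \<in> collinear_triples \<L> S"
    then obtain L where X: "X \<subseteq> S" "card X = 3" "L \<in> \<L>" "X \<subseteq> L"
      by (auto simp: collinear_triples_def)
    have fin: "finite A" "finite B" using assms finite_line by auto
    have "card (X \<inter> A) \<ge> 2 \<or> card (X \<inter> B) \<ge> 2"
    proof -
      have "X = (X \<inter> A) \<union> (X \<inter> B)" using X assms by auto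
      then have "3 \<le> card (X \<inter> A) + card (X \<inter> B)" using X(2) by (metis card_Un_le)
      then show ?thesis by linarith
    qed
    then have "L = A \<or> L = B"
    proof
      assume "2 \<le> card (X \<inter> A)"
      then obtain x y where "x \<in> X \<inter> A" "y \<in> X \<inter> A" "x \<noteq> y"
        using fin by (metis card_le_Suc0_iff_eq finite_Int not_less_eq_eq numeral_2_eq_2)
      then show ?thesis using line_unique[of L A x y] X assms by blast
    next
      assume "2 \<le> card (X \<inter> B)"
      then obtain x y where "x \<in> X \<inter> B" "y \<in> X \<inter> B" "x \<noteq> y"
        using fin by (metis card_le_Suc0_iff_eq finite_Int not_less_eq_eq numeral_2_eq_2)
      then show ?thesis using line_unique[of L B x y] X assms by blast
    qed
    then show "X \<in> {A, B}" using X assms fin by (metis card_subset_eq insertCI)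
  qed
qed

end

text \<open>
  If all lines have at most 20 points, then five points and the lines spanned by them occupy at
  most \<open>5 + 20 \<cdot> 5\<^sup>2 < 600\<close> points, which leaves room for a generic point.
\<close>

locale thick_linear_space = partial_linear_space +
  assumes nonempty: "Q \<noteq> {}"
    and many_lines: "p \<in> Q \<Longrightarrow> 600 \<le> card {L \<in> \<L>. p \<in> L \<and> card L = 3}"
begin

text \<open>Two lines through \<open>p\<close> share no other point, so every point of
  \<open>W\<close> spoils at most one of the 600 lines.\<close>

lemma line_avoiding:
  assumes "p \<in> Q" "p \<notin> W" "finite W" "card W < 600"
  obtains L where "L \<in> \<L>" "p \<in> L" "card L = 3" "L \<inter> W = {}"
proof -
  let ?T = "{L \<in> \<L>. p \<in> L \<and> card L = 3}"
  have "\<exists>L\<in>?T. L \<inter> W = {}"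
  proof (rule ccontr)
    assume no: "\<not> (\<exists>L\<in>?T. L \<inter> W = {})"
    define g where "g L = (SOME w. w \<in> L \<inter> W)" for L
    have g: "g L \<in> L \<inter> W" if "L \<in> ?T" for L
      using no that unfolding g_def by (metis (no_types, lifting) ex_in_conv someI_ex)
    have "inj_on g ?T"
    proof (rule inj_onI)
      fix L L' assume L: "L \<in> ?T" "L' \<in> ?T" and eq: "g L = g L'"
      have "g L \<in> L \<inter> L'" using g[OF L(1)] g[OF L(2)] eq by auto
      moreover have "g L \<noteq> p" using g[OF L(1)] assms by auto
      ultimately show "L = L'" using line_unique[of L L' p "g L"] L by blast
    qed
    then have "card ?T \<le> card W" using g assms by (intro card_inj_on_le[of g]) auto
    then show False using many_lines[OF assms(1)] assms by linarith
  qed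
  then show ?thesis using that by auto
qed

text \<open>With fewer points, all of \<open>Q - {p}\<close> could be avoided, leaving a three-point
  line inside \<open>{p}\<close>.\<close>

lemma card_points: "600 \<le> card Q"
proof (rule ccontr)
  assume less: "\<not> ?thesis"
  obtain p where p: "p \<in> Q" using nonempty by blast
  then obtain L where L: "L \<in> \<L>" "p \<in> L" "card L = 3" "L \<inter> (Q - {p}) = {}"
    using line_avoiding[of p "Q - {p}"] less finite_points
    by (metis DiffD2 card_Diff1_le finite_Diff insertI1 le_less_trans not_le)
  then have "L \<subseteq> {p}" using line_subset by blast
  then have "card L \<le> 1" using card_mono[of "{p}" L] by simp
  with L show False by simp
qed

lemma obtain_line:
  obtains L where "L \<in> \<L>" "card L = 3"
proof -
  obtain p where "p \<in> Q" using nonempty by blast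
  then show ?thesis using line_avoiding[of p "{}"] that by auto
qed

text \<open>This is the pattern of \<open>R6\<close>. A three-point line through a point off
  \<open>A\<close> can be chosen to miss \<open>A\<close>, and the two lines already make up six
  points.\<close>

lemma two_disjoint_lines:
  "\<exists>A B. A \<union> B \<subseteq> Q \<and> card A = 3 \<and> card B = 3 \<and> A \<inter> B = {} \<and>
     collinear_triples \<L> (A \<union> B) = {A, B}"
proof -
  obtain A where A: "A \<in> \<L>" "card A = 3" by (rule obtain_line)
  have "\<not> Q \<subseteq> A" using card_points A card_mono[OF finite_line[OF A(1)], of Q] by auto
  then obtain p where p: "p \<in> Q" "p \<notin> A" by blast
  obtain B where B: "B \<in> \<L>" "p \<in> B" "card B = 3" "B \<inter> A = {}"
    using line_avoiding[OF p] A finite_line[OF A(1)] by auto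
  then show ?thesis using A collinear_triples_eq_union[OF refl A(1) B(1) A(2) B(3)] line_subset
    by (intro exI[of _ A] exI[of _ B]) auto
qed

lemma generic_point:
  assumes short: "\<And>L. L \<in> \<L> \<Longrightarrow> card L \<le> 20" and S: "S \<subseteq> Q" "card S \<le> 5"
  obtains p where "p \<in> Q - S" "collinear_triples \<L> (insert p S) = collinear_triples \<L> S"
proof -
  have finS: "finite S" using S finite_points finite_subset by blast
  have fin: "finite (spanned_lines \<L> S)" using finite_lines by (simp add: spanned_lines_def)
  have "card (\<Union>(spanned_lines \<L> S)) \<le> (\<Sum>L\<in>spanned_lines \<L> S. card L)"
    by (rule card_Union_le_sum_card)
  also have "\<dots> \<le> (\<Sum>L\<in>spanned_lines \<L> S. 20)"
    using short by (intro sum_mono) (auto simp: spanned_lines_def)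
  also have "\<dots> \<le> 20 * (card S * card S)" using card_spanned_lines[OF finS] by simp
  also have "\<dots> \<le> 20 * (5 * 5)" using S by (intro mult_le_mono) auto
  finally have "card (S \<union> \<Union>(spanned_lines \<L> S)) \<le> 505"
    using S card_Un_le[of S "\<Union>(spanned_lines \<L> S)"] by linarith
  moreover have "finite (S \<union> \<Union>(spanned_lines \<L> S))"
    using finS fin finite_line by (auto simp: spanned_lines_def)
  ultimately have "\<not> Q \<subseteq> S \<union> \<Union>(spanned_lines \<L> S)"
    using card_points card_mono[of "S \<union> \<Union>(spanned_lines \<L> S)" Q] by linarith
  then obtain p where p: "p \<in> Q" "p \<notin> S" "p \<notin> \<Union>(spanned_lines \<L> S)" by blast
  \<comment> \<open>A collinear triple through \<open>p\<close> would put two points of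
    \<open>S\<close> on its line, making it one of the spanned lines that \<open>p\<close> was
    chosen to avoid.\<close>
  have "X \<subseteq> S" if X: "X \<subseteq> insert p S" "card X = 3" "L \<in> \<L>" "X \<subseteq> L" for X L
  proof (rule ccontr)
    assume "\<not> X \<subseteq> S"
    then have "p \<in> X" using X by blast
    then have "card (X - {p}) = 2" using X by simp
    then obtain x y where "X - {p} = {x, y}" "x \<noteq> y" by (auto simp: card_2_iff)
    then have "x \<in> S \<inter> L" "y \<in> S \<inter> L" "x \<noteq> y" using X by auto
    then have "L \<in> spanned_lines \<L> S" using X by (auto simp: spanned_lines_def)
    then show False using p X \<open>p \<in> X\<close> by blast
  qed
  then have "collinear_triples \<L> (insert p S) = collinear_triples \<L> S"
    by (auto simp: collinear_triples_def)
  then show ?thesis using that p by blast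
qed

lemma generic_extension:
  assumes short: "\<And>L. L \<in> \<L> \<Longrightarrow> card L \<le> 20" and S: "S \<subseteq> Q" "card S \<le> 6"
  shows "\<exists>T. S \<subseteq> T \<and> T \<subseteq> Q \<and> card T = 6 \<and> collinear_triples \<L> T = collinear_triples \<L> S"
  using S
proof (induction "6 - card S" arbitrary: S)
  case 0
  then show ?case by (intro exI[of _ S]) auto
next
  case (Suc k)
  then have "card S \<le> 5" by linarith
  then obtain p where p: "p \<in> Q - S" "collinear_triples \<L> (insert p S) = collinear_triples \<L> S"
    using Suc(3) generic_point[OF short, of S] by blast
  have "finite S" using Suc finite_points finite_subset by blast
  then have "card (insert p S) = Suc (card S)" using p by simp
  moreover from this have "k = 6 - card (insert p S)" "card (insert p S) \<le> 6" using Suc(2) by linarith+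
  ultimately obtain T where "insert p S \<subseteq> T" "T \<subseteq> Q" "card T = 6"
      "collinear_triples \<L> T = collinear_triples \<L> (insert p S)"
    using Suc(1)[of "insert p S"] p Suc by blast
  with p show ?case by auto
qed

text \<open>Each of the at most 16 lines spanned by \<open>T\<close> differs from \<open>L0\<close>,
  hence meets it in at most one point. Together with \<open>A\<close> at most 17 points of
  \<open>L0\<close> are forbidden, which leaves the three needed among more than 20. The new
  collinear triples then all lie on \<open>L0\<close>.\<close>

lemma add_points_of_long_line:
  assumes L0: "L0 \<in> \<L>" "20 < card L0" and T: "T \<subseteq> Q - L0" "card T \<le> 4"
    and A: "A \<subseteq> L0" "card A \<le> 1" and j: "j \<le> 3"
  obtains G where "G \<subseteq> L0 - A" "card G = j"
    "collinear_triples \<L> (T \<union> A \<union> G) =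
       collinear_triples \<L> (T \<union> A) \<union> {X. X \<subseteq> A \<union> G \<and> card X = 3}"
proof -
  have finT: "finite T" using T finite_points finite_subset by blast
  have fin0: "finite L0" using L0 finite_line by blast
  have finA: "finite A" using A fin0 finite_subset by blast
  let ?B = "L0 \<inter> \<Union>(spanned_lines \<L> T)"
  let ?g = "\<lambda>L. THE q. q \<in> L0 \<inter> L"
  have "?B \<subseteq> ?g ` spanned_lines \<L> T"
  proof
    fix q assume "q \<in> ?B"
    then obtain L where L: "q \<in> L0 \<inter> L" "L \<in> spanned_lines \<L> T" by blast
    then have "L \<noteq> L0" "L \<in> \<L>" using T by (auto simp: spanned_lines_def)
    then have "?g L = q" using L line_unique L0 by (intro the_equality) blast+
    then show "q \<in> ?g ` spanned_lines \<L> T" using L by blast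
  qed
  moreover have fsp: "finite (spanned_lines \<L> T)" using finite_lines by (simp add: spanned_lines_def)
  ultimately have "card ?B \<le> card (spanned_lines \<L> T)"
    by (meson card_image_le card_mono finite_imageI le_trans)
  also have "\<dots> \<le> card T * card T" by (rule card_spanned_lines[OF finT])
  also have "\<dots> \<le> 4 * 4" using T by (intro mult_le_mono) auto
  finally have "card (?B \<union> A) \<le> 17" using A card_Un_le[of ?B A] by linarith
  then have "j \<le> card (L0 - (?B \<union> A))"
    using L0 j diff_card_le_card_Diff[of "?B \<union> A" L0] fin0 finA by auto
  then obtain G where G: "G \<subseteq> L0 - (?B \<union> A)" "card G = j" by (metis obtain_subset_with_card_n)
  \<comment> \<open>If a triple with a new point \<open>g\<close> lies on a line other than
    \<open>L0\<close>, that line meets \<open>L0\<close> in \<open>g\<close> alone. The other two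
    points are then in \<open>T\<close>, so \<open>g\<close> is on a spanned line and was
    forbidden.\<close>
  have "X \<subseteq> T \<union> A"
    if X: "X \<subseteq> T \<union> A \<union> G" "card X = 3" "L \<in> \<L>" "X \<subseteq> L" "\<not> X \<subseteq> A \<union> G" for X L
  proof (rule ccontr)
    assume "\<not> X \<subseteq> T \<union> A"
    then obtain g where g: "g \<in> X" "g \<in> G" using X by blast
    have "L \<noteq> L0" using X T by blast
    then have *: "x = g" if "x \<in> L \<inter> L0" for x
      using that g G X line_unique[OF X(3) L0(1), of x g] by blast
    have "card (X - {g}) = 2" using X g by simp
    then obtain x y where xy: "X - {g} = {x, y}" "x \<noteq> y" by (auto simp: card_2_iff)
    have AG: "A \<union> G \<subseteq> L0" using A G by blast
    have "z \<in> T \<inter> L" if z: "z \<in> X - {g}" for z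
    proof (rule ccontr)
      assume "z \<notin> T \<inter> L"
      then have "z \<in> L \<inter> L0" using z X AG by blast
      then show False using * z by blast
    qed
    then have "x \<in> T \<inter> L" "y \<in> T \<inter> L" using xy by auto
    then have "L \<in> spanned_lines \<L> T" using X xy by (auto simp: spanned_lines_def)
    then show False using g G X by blast
  qed
  note old = this
  have AG: "A \<union> G \<subseteq> L0" using A G by blast
  have "collinear_triples \<L> (T \<union> A \<union> G) =
       collinear_triples \<L> (T \<union> A) \<union> {X. X \<subseteq> A \<union> G \<and> card X = 3}"
  proof (intro equalityI subsetI)
    fix X assume X: "X \<in> collinear_triples \<L> (T \<union> A \<union> G)"
    then obtain L where L: "L \<in> \<L>" "X \<subseteq> L" "X \<subseteq> T \<union> A \<union> G" "card X = 3"
      by (auto simp: collinear_triples_def)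
    then show "X \<in> collinear_triples \<L> (T \<union> A) \<union> {X. X \<subseteq> A \<union> G \<and> card X = 3}"
      using old[of X L] by (auto simp: collinear_triples_def)
  next
    fix X assume "X \<in> collinear_triples \<L> (T \<union> A) \<union> {X. X \<subseteq> A \<union> G \<and> card X = 3}"
    then consider "X \<in> collinear_triples \<L> (T \<union> A)" | "X \<subseteq> A \<union> G" "card X = 3" by blast
    then show "X \<in> collinear_triples \<L> (T \<union> A \<union> G)"
    proof cases
      case 1
      then show ?thesis by (auto simp: collinear_triples_def)
    next
      case 2
      then have "X \<subseteq> L0" "X \<subseteq> T \<union> A \<union> G" using AG by auto
      then show ?thesis using 2 L0(1) by (auto simp: collinear_triples_def)
    qed
  qed
  then show ?thesis by (rule that[rotated 2]) (use G in auto)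
qed

text \<open>This supplies points off \<open>L0\<close>: a three-point line is not \<open>L0\<close>,
  so if it passes through a point of \<open>L0\<close> it has exactly two points outside. Since
  \<open>B\<close> avoids \<open>A\<close>, the collinear triples of their union are known.\<close>

lemma two_lines_off_long_line:
  assumes L0: "L0 \<in> \<L>" "20 < card L0"
  obtains A B x where "A \<in> \<L>" "B \<in> \<L>" "card A = 3" "card B = 3" "A \<inter> B = {}"
    "A \<inter> L0 = {x}" "card (A - L0) = 2" "card (B - L0) = 2"
proof -
  have fin0: "finite L0" using L0 finite_line by blast
  have meet: "L \<inter> L0 = {x}" "card (L - L0) = 2"
    if L: "L \<in> \<L>" "card L = 3" "x \<in> L" "x \<in> L0" for L x
  proof -
    have "L \<noteq> L0" using L L0 by auto
    then show "L \<inter> L0 = {x}" using L line_unique L0 by blast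
    then show "card (L - L0) = 2" using L finite_line[OF L(1)]
      by (simp add: card_Diff_subset_Int)
  qed
  obtain x where x: "x \<in> L0" using L0 by fastforce
  obtain A where A: "A \<in> \<L>" "x \<in> A" "card A = 3"
    using line_avoiding[of x "{}"] x L0 line_subset by auto
  note mA = meet[OF A(1,3,2) x]
  have "\<not> L0 \<subseteq> A" using mA A L0 by (auto simp: Int_absorb1)
  then obtain y where y: "y \<in> L0" "y \<notin> A" by blast
  obtain B where B: "B \<in> \<L>" "y \<in> B" "card B = 3" "B \<inter> A = {}"
    using line_avoiding[of y A] y L0 line_subset A finite_line[OF A(1)] by auto
  note mB = meet[OF B(1,3,2) y(1)]
  show ?thesis using that[OF A(1) B(1) A(3) B(3) _ mA mB(2)] B(4) by blast
qed

section \<open>Six points with none, one or two meeting collinear triples\<close>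

text \<open>The pattern of \<open>uniform_matroid 3 6\<close>. With short lines it grows from the
  empty set by generic points. Otherwise two disjoint three-point lines, stripped of their points on
  \<open>L0\<close>, leave four points without a collinear triple, and two generic points of
  \<open>L0\<close> are added.\<close>

lemma six_points_no_line:
  "\<exists>S \<subseteq> Q. card S = 6 \<and> collinear_triples \<L> S = {}"
proof (cases "\<forall>L\<in>\<L>. card L \<le> 20")
  case True
  have "collinear_triples \<L> {} = {}" by (auto simp: collinear_triples_def)
  with True show ?thesis using generic_extension[of "{}"] by auto
next
  case False
  then obtain L0 where L0: "L0 \<in> \<L>" "20 < card L0" by force
  obtain A B x where AB: "A \<in> \<L>" "B \<in> \<L>" "card A = 3" "card B = 3" "A \<inter> B = {}"
    "A \<inter> L0 = {x}" "card (A - L0) = 2" "card (B - L0) = 2"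
    by (rule two_lines_off_long_line[OF L0])
  define T where "T = (A - L0) \<union> (B - L0)"
  have fin: "finite A" "finite B" "finite L0" using AB L0 finite_line by auto
  have cT: "card T = 4" unfolding T_def using AB fin by (subst card_Un_disjoint) auto
  have TQ: "T \<subseteq> Q - L0" using AB line_subset by (auto simp: T_def)
  obtain G where G: "G \<subseteq> L0 - {}" "card G = 2"
    "collinear_triples \<L> (T \<union> {} \<union> G) =
       collinear_triples \<L> (T \<union> {}) \<union> {X. X \<subseteq> {} \<union> G \<and> card X = 3}"
    using add_points_of_long_line[OF L0 TQ, of "{}" 2] cT by auto
  have finG: "finite G" using G finite_subset fin by blast
  have "collinear_triples \<L> T \<subseteq> collinear_triples \<L> (A \<union> B)"
    by (auto simp: collinear_triples_def T_def)
  then have "collinear_triples \<L> T \<subseteq> {A, B}"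
    using collinear_triples_eq_union[OF refl AB(1-4)] by simp
  moreover have "\<not> A \<subseteq> T" using AB by (auto simp: T_def)
  moreover have "\<not> B \<subseteq> T"
  proof
    assume "B \<subseteq> T"
    then have "B - L0 = B" using AB by (auto simp: T_def)
    then show False using AB by simp
  qed
  ultimately have "collinear_triples \<L> T = {}" by (auto simp: collinear_triples_def)
  moreover have "\<not> X \<subseteq> G" if "card X = 3" for X
    using card_mono[OF finG, of X] that G by auto
  ultimately have "collinear_triples \<L> (T \<union> G) = {}" using G by auto
  moreover have "card (T \<union> G) = 6"
  proof -
    have "T \<inter> G = {}" using TQ G(1) by blast
    moreover have "finite T" using cT by (simp add: card_ge_0_finite)
    ultimately show ?thesis using cT G(2) finG by (simp add: card_Un_disjoint)
  qed
  moreover have "T \<union> G \<subseteq> Q" using TQ G L0 line_subset by blast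
  ultimately show ?thesis by blast
qed

text \<open>The pattern of \<open>P6\<close>. If there is a long line, three generic points of it
  form the only collinear triple; the other three points are two of \<open>A\<close> and one of
  \<open>B\<close>, all off \<open>L0\<close>.\<close>

lemma six_points_one_line:
  "\<exists>S \<subseteq> Q. card S = 6 \<and> (\<exists>X. collinear_triples \<L> S = {X})"
proof (cases "\<forall>L\<in>\<L>. card L \<le> 20")
  case True
  obtain A where A: "A \<in> \<L>" "card A = 3" by (rule obtain_line)
  then have "collinear_triples \<L> A = {A}" using collinear_triples_eq_union[of A A A] by auto
  with True A show ?thesis using generic_extension[of A] line_subset[OF A(1)] by force
next
  case False
  then obtain L0 where L0: "L0 \<in> \<L>" "20 < card L0" by force
  obtain A B x where AB: "A \<in> \<L>" "B \<in> \<L>" "card A = 3" "card B = 3" "A \<inter> B = {}"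
    "A \<inter> L0 = {x}" "card (A - L0) = 2" "card (B - L0) = 2"
    by (rule two_lines_off_long_line[OF L0])
  have "B - L0 \<noteq> {}" using AB(8) by (metis card.empty zero_neq_numeral)
  then obtain b where b: "b \<in> B - L0" by blast
  define T where "T = insert b (A - L0)"
  have fin: "finite A" "finite B" "finite L0" using AB L0 finite_line by auto
  have cT: "card T = 3" unfolding T_def using AB fin b by (subst card_insert_disjoint) auto
  have TQ: "T \<subseteq> Q - L0" using AB line_subset b by (auto simp: T_def)
  obtain G where G: "G \<subseteq> L0 - {}" "card G = 3"
    "collinear_triples \<L> (T \<union> {} \<union> G) =
       collinear_triples \<L> (T \<union> {}) \<union> {X. X \<subseteq> {} \<union> G \<and> card X = 3}"
    using add_points_of_long_line[OF L0 TQ, of "{}" 3] cT by auto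
  have finG: "finite G" using G finite_subset fin by blast
  have "collinear_triples \<L> T \<subseteq> collinear_triples \<L> (A \<union> B)"
    using b by (auto simp: collinear_triples_def T_def)
  then have "collinear_triples \<L> T \<subseteq> {A, B}"
    using collinear_triples_eq_union[OF refl AB(1-4)] by simp
  moreover have "\<not> A \<subseteq> T" using AB b by (auto simp: T_def)
  moreover have "\<not> B \<subseteq> T"
  proof
    assume "B \<subseteq> T"
    then have "B - L0 = B" using AB b by (auto simp: T_def)
    then show False using AB by simp
  qed
  ultimately have "collinear_triples \<L> T = {}" by (auto simp: collinear_triples_def)
  moreover have "X = G" if "X \<subseteq> G" "card X = 3" for X
    using card_subset_eq[OF finG that(1)] that G(2) by simp
  then have "{X. X \<subseteq> G \<and> card X = 3} = {G}" using G(2) by auto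
  ultimately have "collinear_triples \<L> (T \<union> G) = {G}" using G by auto
  moreover have "card (T \<union> G) = 6"
  proof -
    have "T \<inter> G = {}" using TQ G(1) by blast
    moreover have "finite T" using cT by (simp add: card_ge_0_finite)
    ultimately show ?thesis using cT G(2) finG by (simp add: card_Un_disjoint)
  qed
  moreover have "T \<union> G \<subseteq> Q" using TQ G L0 line_subset by blast
  ultimately show ?thesis by blast
qed

text \<open>The pattern of \<open>Q6\<close>. With short lines, two three-point lines through
  \<open>a\<close> receive one generic point. Otherwise the two triples are \<open>A\<close> and a
  triple of \<open>L0\<close> through the common point \<open>x\<close>, and the sixth point is a
  point \<open>b\<close> of \<open>B\<close> off \<open>L0\<close>.\<close>

lemma six_points_two_meeting_lines:
  "\<exists>S \<subseteq> Q. card S = 6 \<and> (\<exists>X Y a. X \<inter> Y = {a} \<and> collinear_triples \<L> S = {X, Y})"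
proof (cases "\<forall>L\<in>\<L>. card L \<le> 20")
  case True
  obtain A where A: "A \<in> \<L>" "card A = 3" by (rule obtain_line)
  then obtain a where a: "a \<in> A" by fastforce
  have fA: "finite A" using A finite_line by blast
  \<comment> \<open>Avoiding \<open>A - {a}\<close> rather than \<open>A\<close> makes the two lines
    meet exactly in \<open>a\<close>.\<close>
  obtain B where B: "B \<in> \<L>" "a \<in> B" "card B = 3" "B \<inter> (A - {a}) = {}"
    using line_avoiding[of a "A - {a}"] a A line_subset[OF A(1)] fA by auto
  have "card (A \<union> B) \<le> 6" using A B card_Un_le[of A B] by simp
  moreover have "A \<union> B \<subseteq> Q" using A B line_subset by blast
  moreover have "A \<inter> B = {a}" using a B by blast
  ultimately show ?thesis
    using generic_extension[of "A \<union> B"] True collinear_triples_eq_union[OF refl A(1) B(1) A(2) B(3)]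
    by (metis (no_types, lifting))
next
  case False
  then obtain L0 where L0: "L0 \<in> \<L>" "20 < card L0" by force
  obtain A B x where AB: "A \<in> \<L>" "B \<in> \<L>" "card A = 3" "card B = 3" "A \<inter> B = {}"
    "A \<inter> L0 = {x}" "card (A - L0) = 2" "card (B - L0) = 2"
    by (rule two_lines_off_long_line[OF L0])
  have "B - L0 \<noteq> {}" using AB(8) by (metis card.empty zero_neq_numeral)
  then obtain b where b: "b \<in> B - L0" by blast
  define T where "T = insert b (A - L0)"
  have fin: "finite A" "finite B" "finite L0" using AB L0 finite_line by auto
  have cT: "card T = 3" unfolding T_def using AB fin b by (subst card_insert_disjoint) auto
  have TQ: "T \<subseteq> Q - L0" using AB line_subset b by (auto simp: T_def)
  have x: "x \<in> L0" using AB by blast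
  \<comment> \<open>The point \<open>x\<close> lies on both \<open>A\<close> and \<open>L0\<close>,
    so it enters as the old point of \<open>L0\<close> and only two new ones are added.\<close>
  obtain G where G: "G \<subseteq> L0 - {x}" "card G = 2"
    "collinear_triples \<L> (T \<union> {x} \<union> G) =
       collinear_triples \<L> (T \<union> {x}) \<union> {X. X \<subseteq> {x} \<union> G \<and> card X = 3}"
    using add_points_of_long_line[OF L0 TQ, of "{x}" 2] cT x by auto
  have finG: "finite G" using G finite_subset fin by blast
  have eq: "T \<union> {x} = insert b A" using AB by (auto simp: T_def)
  have "collinear_triples \<L> (insert b A) \<subseteq> collinear_triples \<L> (A \<union> B)"
    using b by (auto simp: collinear_triples_def)
  then have "collinear_triples \<L> (insert b A) \<subseteq> {A, B}"
    using collinear_triples_eq_union[OF refl AB(1-4)] by simp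
  moreover have "\<not> B \<subseteq> insert b A"
  proof
    assume "B \<subseteq> insert b A"
    then have "B \<subseteq> {b}" using AB b by auto
    then have "card B \<le> 1" using card_mono[of "{b}" B] by simp
    then show False using AB by simp
  qed
  moreover have "A \<in> collinear_triples \<L> (insert b A)" using AB by (auto simp: collinear_triples_def)
  ultimately have "collinear_triples \<L> (insert b A) = {A}" by (auto simp: collinear_triples_def)
  moreover have cG: "card (insert x G) = 3" using G finG by (subst card_insert_disjoint) auto
  moreover have "X = insert x G" if "X \<subseteq> insert x G" "card X = 3" for X
    using card_subset_eq[OF _ that(1)] finG that cG by simp
  then have "{X. X \<subseteq> {x} \<union> G \<and> card X = 3} = {insert x G}" using cG by auto
  ultimately have "collinear_triples \<L> (T \<union> insert x G) = {A, insert x G}" using G eq by auto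
  moreover have "card (T \<union> insert x G) = 6"
  proof -
    have "T \<inter> insert x G = {}" using TQ G(1) x by blast
    moreover have "finite T" using cT by (simp add: card_ge_0_finite)
    moreover have "finite (insert x G)" using finG by simp
    ultimately show ?thesis using cT cG card_Un_disjoint[of T "insert x G"] by linarith
  qed
  moreover have "T \<union> insert x G \<subseteq> Q" using TQ G L0 line_subset x by blast
  moreover have "A \<inter> insert x G = {x}" using AB G by blast
  ultimately show ?thesis by blast
qed

end

text \<open>
  A smallest \<open>Q\<close> violating the linear bound works: deleting a point of it destroys at least 600
  lines, and a line destroyed in this way has exactly three points.
\<close>

lemma thick_restriction:
  assumes pls: "partial_linear_space P \<L>" and many: "600 * card P < card {L \<in> \<L>. 3 \<le> card L}"
  obtains Q where "Q \<subseteq> P"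
    "thick_linear_space Q ((\<lambda>L. L \<inter> Q) ` {L \<in> \<L>. 3 \<le> card (L \<inter> Q)})"
proof -
  interpret partial_linear_space P \<L> by fact
  define rich where "rich Q = {L \<in> \<L>. 3 \<le> card (L \<inter> Q)}" for Q
  have fin_rich: "finite (rich Q)" for Q using finite_lines by (simp add: rich_def)
  define ok where "ok Q \<longleftrightarrow> Q \<subseteq> P \<and> 600 * card Q < card (rich Q)" for Q
  have "{L \<in> \<L>. 3 \<le> card L} = rich P"
    using line_subset by (auto simp: rich_def Int_absorb2)
  then have "ok P" using many by (simp add: ok_def)
  then obtain Q where Q: "ok Q" and min: "\<And>Q'. ok Q' \<Longrightarrow> card Q \<le> card Q'"
    using ex_has_least_nat[of ok P card] by blast
  have QP: "Q \<subseteq> P" and finQ: "finite Q" using Q finite_points finite_subset by (auto simp: ok_def)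
  define \<K> where "\<K> = (\<lambda>L. L \<inter> Q) ` rich Q"
  \<comment> \<open>A trace with three points determines its line, so counting traces on
    \<open>Q\<close> is counting lines.\<close>
  have inj: "inj_on (\<lambda>L. L \<inter> Q) (rich Q)"
  proof (rule inj_onI)
    fix L L' assume L: "L \<in> rich Q" "L' \<in> rich Q" "L \<inter> Q = L' \<inter> Q"
    then have "\<not> card (L \<inter> Q) \<le> Suc 0" by (auto simp: rich_def)
    then obtain x y where "x \<in> L \<inter> Q" "y \<in> L \<inter> Q" "x \<noteq> y"
      using finQ by (metis card_le_Suc0_iff_eq finite_Int)
    then show "L = L'" using line_unique[of L L' x y] L by (auto simp: rich_def)
  qed
  have "thick_linear_space Q \<K>"
  proof
    show "finite Q" by (rule finQ)
    show "L \<subseteq> Q" if "L \<in> \<K>" for L using that by (auto simp: \<K>_def)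
    show "L = L'" if "L \<in> \<K>" "L' \<in> \<K>" "x \<in> L \<inter> L'" "y \<in> L \<inter> L'" "x \<noteq> y" for L L' x y
    proof -
      obtain K K' where K: "K \<in> \<L>" "K' \<in> \<L>" "L = K \<inter> Q" "L' = K' \<inter> Q"
        using \<open>L \<in> \<K>\<close> \<open>L' \<in> \<K>\<close> by (auto simp: \<K>_def rich_def)
      then show ?thesis using line_unique[of K K' x y] that by blast
    qed
    \<comment> \<open>Strictness in \<open>ok\<close> excludes the empty set, in which no line has
      three points.\<close>
    show "Q \<noteq> {}" using Q by (auto simp: ok_def rich_def)
    show "600 \<le> card {L \<in> \<K>. p \<in> L \<and> card L = 3}" if p: "p \<in> Q" for p
    proof -
      have cQ: "card (Q - {p}) = card Q - 1" "card Q > 0" using p finQ by (auto simp: card_gt_0_iff)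
      then have "\<not> ok (Q - {p})" using min[of "Q - {p}"] by auto
      then have 1: "card (rich (Q - {p})) \<le> 600 * (card Q - 1)" using QP cQ by (auto simp: ok_def)
      have sub: "rich (Q - {p}) \<subseteq> rich Q"
      proof
        fix L assume "L \<in> rich (Q - {p})"
        moreover have "card (L \<inter> (Q - {p})) \<le> card (L \<inter> Q)" using finQ by (intro card_mono) auto
        ultimately show "L \<in> rich Q" by (auto simp: rich_def)
      qed
      have "600 \<le> card (rich Q) - card (rich (Q - {p}))"
        using 1 Q cQ unfolding ok_def by (cases "card Q") auto
      also have "\<dots> = card (rich Q - rich (Q - {p}))"
        using sub fin_rich by (simp add: card_Diff_subset)
      also have "\<dots> = card ((\<lambda>L. L \<inter> Q) ` (rich Q - rich (Q - {p})))"
        by (rule card_image[symmetric]) (rule inj_on_subset[OF inj Diff_subset])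
      also have "\<dots> \<le> card {L \<in> \<K>. p \<in> L \<and> card L = 3}"
      proof (rule card_mono)
        show "finite {L \<in> \<K>. p \<in> L \<and> card L = 3}" using fin_rich by (simp add: \<K>_def)
        show "(\<lambda>L. L \<inter> Q) ` (rich Q - rich (Q - {p})) \<subseteq> {L \<in> \<K>. p \<in> L \<and> card L = 3}"
        proof clarify
          fix L assume L: "L \<in> rich Q" "L \<notin> rich (Q - {p})"
          have eq: "L \<inter> (Q - {p}) = L \<inter> Q - {p}" by blast
          have "3 \<le> card (L \<inter> Q)" "card (L \<inter> Q - {p}) < 3" using L eq by (auto simp: rich_def)
          moreover from this have "p \<in> L \<inter> Q" by (metis Diff_empty Diff_insert0 not_le)
          ultimately show "L \<inter> Q \<in> \<K> \<and> p \<in> L \<inter> Q \<and> card (L \<inter> Q) = 3"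
            using L finQ by (auto simp: \<K>_def)
        qed
      qed
      finally show ?thesis .
    qed
  qed
  then show ?thesis using that QP unfolding \<K>_def rich_def by blast
qed

text \<open>A line carrying a triple of \<open>S\<close> has three points in \<open>Q\<close>, so
  its trace is kept; patterns found in the restriction are patterns of the original space.\<close>

lemma collinear_triples_restrict:
  assumes "S \<subseteq> Q" "finite Q"
  shows "collinear_triples ((\<lambda>L. L \<inter> Q) ` {L \<in> \<L>. 3 \<le> card (L \<inter> Q)}) S = collinear_triples \<L> S"
proof -
  have "3 \<le> card (L \<inter> Q)" if "X \<subseteq> L" "X \<subseteq> S" "card X = 3" for X L
    using that assms card_mono[of "L \<inter> Q" X] by auto
  note large = this
  have *: "(\<exists>L\<in>(\<lambda>L. L \<inter> Q) ` {L \<in> \<L>. 3 \<le> card (L \<inter> Q)}. X \<subseteq> L) \<longleftrightarrow> (\<exists>L\<in>\<L>. X \<subseteq> L)"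
    if X: "X \<subseteq> S" "card X = 3" for X
  proof
    assume "\<exists>L\<in>\<L>. X \<subseteq> L"
    then obtain L where L: "L \<in> \<L>" "X \<subseteq> L" by (elim bexE)
    have "L \<inter> Q \<in> (\<lambda>L. L \<inter> Q) ` {L \<in> \<L>. 3 \<le> card (L \<inter> Q)}"
      using L large[OF L(2) X] by simp
    moreover have "X \<subseteq> L \<inter> Q" using L(2) X(1) assms(1) by simp
    ultimately show "\<exists>L\<in>(\<lambda>L. L \<inter> Q) ` {L \<in> \<L>. 3 \<le> card (L \<inter> Q)}. X \<subseteq> L" by (rule bexI[rotated])
  next
    assume "\<exists>L\<in>(\<lambda>L. L \<inter> Q) ` {L \<in> \<L>. 3 \<le> card (L \<inter> Q)}. X \<subseteq> L"
    then show "\<exists>L\<in>\<L>. X \<subseteq> L" by auto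
  qed
  show ?thesis
  proof (rule set_eqI)
    fix X
    show "X \<in> collinear_triples ((\<lambda>L. L \<inter> Q) ` {L \<in> \<L>. 3 \<le> card (L \<inter> Q)}) S \<longleftrightarrow>
        X \<in> collinear_triples \<L> S"
      using *[of X] unfolding collinear_triples_def mem_Collect_eq by argo
  qed
qed

section \<open>Rank and rank-three matroids\<close>

definition rk :: "'a set_system \<Rightarrow> 'a set \<Rightarrow> nat" where
  "rk M A = Max (card ` {X \<in> indeps M. X \<subseteq> A})"

lemma matroid_empty_indep: "matroid M \<Longrightarrow> {} \<in> indeps M"
  by (simp add: matroid_def)

lemma matroid_indep_subset: "matroid M \<Longrightarrow> Y \<in> indeps M \<Longrightarrow> X \<subseteq> Y \<Longrightarrow> X \<in> indeps M"
  unfolding matroid_def by metis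

lemma matroid_indep_ground: "matroid M \<Longrightarrow> X \<in> indeps M \<Longrightarrow> X \<subseteq> ground M"
  by (auto simp: matroid_def)

lemma matroid_finite_ground: "matroid M \<Longrightarrow> finite (ground M)"
  by (simp add: matroid_def)

lemma matroid_finite_indeps: "matroid M \<Longrightarrow> finite (indeps M)"
  unfolding matroid_def by (meson finite_Pow_iff finite_subset)

lemma rk_eq_card_basis:
  assumes M: "matroid M" and B: "basis_of M A B"
  shows "rk M A = card B"
  unfolding rk_def
proof (rule Max_eqI)
  show "finite (card ` {X \<in> indeps M. X \<subseteq> A})" using matroid_finite_indeps[OF M] by simp
  show "y \<le> card B" if "y \<in> card ` {X \<in> indeps M. X \<subseteq> A}" for y
    using that basis_of_card_le[OF M B] by auto
  show "card B \<in> card ` {X \<in> indeps M. X \<subseteq> A}" using B by (auto simp: basis_of_def)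
qed

lemma card_indep_le_rk:
  assumes "matroid M" "X \<in> indeps M" "X \<subseteq> A"
  shows "card X \<le> rk M A"
proof -
  obtain B where "basis_of M A B" using basis_of_exists[OF assms(1)] by blast
  then show ?thesis using basis_of_card_le rk_eq_card_basis assms by metis
qed

lemma rk_le_iff:
  assumes M: "matroid M"
  shows "rk M A \<le> k \<longleftrightarrow> (\<forall>X\<in>indeps M. X \<subseteq> A \<longrightarrow> card X \<le> k)"
proof
  assume "rk M A \<le> k"
  then show "\<forall>X\<in>indeps M. X \<subseteq> A \<longrightarrow> card X \<le> k" using card_indep_le_rk[OF M] order_trans by blast
next
  assume *: "\<forall>X\<in>indeps M. X \<subseteq> A \<longrightarrow> card X \<le> k"
  obtain B where B: "basis_of M A B" using basis_of_exists[OF M] by blast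
  then show "rk M A \<le> k" using * rk_eq_card_basis[OF M B] by (simp add: basis_of_def)
qed

lemma rk_mono:
  assumes "matroid M" "A \<subseteq> B"
  shows "rk M A \<le> rk M B"
proof (rule rk_le_iff[OF assms(1), THEN iffD2], intro ballI impI)
  fix X assume "X \<in> indeps M" "X \<subseteq> A"
  then show "card X \<le> rk M B"
    using assms(2) by (intro card_indep_le_rk[OF assms(1)]) simp_all
qed

lemma rk_le_card:
  assumes "matroid M" "finite A"
  shows "rk M A \<le> card A"
  by (rule rk_le_iff[OF assms(1), THEN iffD2]) (intro ballI impI card_mono assms(2))

lemma rk_eq_card_iff:
  assumes M: "matroid M" and A: "finite A"
  shows "rk M A = card A \<longleftrightarrow> A \<in> indeps M"
proof
  assume eq: "rk M A = card A"
  obtain B where B: "basis_of M A B" using basis_of_exists[OF M] by blast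
  then have "B \<subseteq> A" "card B = card A" using eq rk_eq_card_basis[OF M B] by (auto simp: basis_of_def)
  then have "B = A" using A by (simp add: card_subset_eq)
  then show "A \<in> indeps M" using B by (simp add: basis_of_def)
next
  assume "A \<in> indeps M"
  then show "rk M A = card A"
    using card_indep_le_rk[OF M, of A A] rk_le_card[OF M A] by simp
qed

lemma basis_of_extend:
  assumes M: "matroid M" and X: "X \<in> indeps M" "X \<subseteq> A"
  obtains B where "basis_of M A B" "X \<subseteq> B"
proof -
  let ?S = "{B \<in> indeps M. B \<subseteq> A}"
  have "finite ?S" using matroid_finite_indeps[OF M] by simp
  moreover have "X \<in> ?S" using X by simp
  ultimately obtain B where B: "B \<in> ?S" "X \<subseteq> B" "\<And>B'. B' \<in> ?S \<Longrightarrow> B \<subseteq> B' \<Longrightarrow> B' = B"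
    by (metis (no_types, lifting) finite_has_maximal2)
  have "basis_of M A B" using B(1) B(3) by (simp add: basis_of_def)
  then show ?thesis using B(2) by (rule that)
qed

text \<open>Bases \<open>J\<close>, \<open>K\<close>, \<open>T\<close> of the intersection, of
  \<open>A\<close> and of the union are chosen increasing. The elements of \<open>T\<close> outside
  \<open>K\<close> lie in \<open>B\<close> and are independent together with
  \<open>J\<close>.\<close>

lemma rk_submodular:
  assumes M: "matroid M"
  shows "rk M (A \<union> B) + rk M (A \<inter> B) \<le> rk M A + rk M B"
proof -
  obtain J where J: "basis_of M (A \<inter> B) J" using basis_of_exists[OF M] by blast
  then have "J \<in> indeps M" "J \<subseteq> A" by (auto simp: basis_of_def)
  then obtain K where K: "basis_of M A K" "J \<subseteq> K" using basis_of_extend[OF M] by blast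
  then have "K \<in> indeps M" "K \<subseteq> A \<union> B" by (auto simp: basis_of_def)
  then obtain T where T: "basis_of M (A \<union> B) T" "K \<subseteq> T" using basis_of_extend[OF M] by blast
  have indT: "T \<in> indeps M" and TAB: "T \<subseteq> A \<union> B" using T by (auto simp: basis_of_def)
  have finT: "finite T" using indT matroid_finite_indep[OF M] by blast
  have "T \<inter> A \<in> indeps M" using matroid_indep_subset[OF M indT] by blast
  moreover have "K \<subseteq> T \<inter> A" using K T by (auto simp: basis_of_def)
  ultimately have TA: "T \<inter> A = K" using K(1) by (auto simp: basis_of_def)
  have ind: "J \<union> (T - K) \<in> indeps M"
    by (rule matroid_indep_subset[OF M indT]) (use K(2) T(2) in auto)
  have "J \<subseteq> B" using J by (simp add: basis_of_def)
  then have "J \<union> (T - K) \<subseteq> B" using TA TAB by auto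
  then have "card (J \<union> (T - K)) \<le> rk M B" using card_indep_le_rk[OF M ind] by blast
  moreover have "card (J \<union> (T - K)) = card J + card (T - K)"
  proof (rule card_Un_disjoint)
    show "finite J" using K(2) T(2) finT by (meson finite_subset)
    show "finite (T - K)" "J \<inter> (T - K) = {}" using finT K(2) by auto
  qed
  moreover have "card T = card K + card (T - K)"
    using T(2) finT by (metis card_Diff_subset card_mono finite_subset le_add_diff_inverse)
  ultimately show ?thesis
    using rk_eq_card_basis[OF M J] rk_eq_card_basis[OF M K(1)] rk_eq_card_basis[OF M T(1)] by linarith
qed

section \<open>Lines and simplification of a rank-three matroid\<close>

text \<open>In rank three these are the flats of rank 2, each with all loops and with everything
  parallel to its elements.\<close>

definition maximal_lines :: "'a set_system \<Rightarrow> 'a set set" where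
  "maximal_lines M = {F. F \<subseteq> ground M \<and> rk M F \<le> 2 \<and>
     (\<forall>G. F \<subseteq> G \<and> G \<subseteq> ground M \<and> rk M G \<le> 2 \<longrightarrow> G = F)}"

lemma maximal_lines_finite: "matroid M \<Longrightarrow> finite (maximal_lines M)"
  by (rule finite_subset[of _ "Pow (ground M)"]) (auto simp: maximal_lines_def matroid_finite_ground)

lemma maximal_line_extend:
  assumes M: "matroid M" and X: "X \<subseteq> ground M" "rk M X \<le> 2"
  obtains F where "F \<in> maximal_lines M" "X \<subseteq> F"
proof -
  let ?S = "{F. F \<subseteq> ground M \<and> rk M F \<le> 2}"
  have "finite ?S" using matroid_finite_ground[OF M] by simp
  moreover have "X \<in> ?S" using X by simp
  ultimately obtain F where F: "F \<in> ?S" "X \<subseteq> F" "\<And>G. G \<in> ?S \<Longrightarrow> F \<subseteq> G \<Longrightarrow> G = F"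
    by (metis (no_types, lifting) finite_has_maximal2)
  have "F \<in> maximal_lines M" using F(1) F(3) by (simp add: maximal_lines_def)
  then show ?thesis using F(2) by (rule that)
qed

text \<open>Submodularity bounds the rank of the union by 2 + 2 - 2, and maximality of both lines
  does the rest.\<close>

lemma maximal_lines_meet:
  assumes M: "matroid M" and FG: "F \<in> maximal_lines M" "G \<in> maximal_lines M"
    and rk: "2 \<le> rk M (F \<inter> G)"
  shows "F = G"
proof -
  have "rk M (F \<union> G) \<le> 2"
    using rk_submodular[OF M, of F G] rk FG by (simp add: maximal_lines_def)
  moreover have "F \<union> G \<subseteq> ground M" using FG by (auto simp: maximal_lines_def)
  ultimately have "F \<union> G = F" "F \<union> G = G"
    using FG unfolding maximal_lines_def by auto
  then show ?thesis by simp
qed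

text \<open>As \<open>x\<close> is not a loop, submodularity bounds the rank of
  \<open>F \<union> {x, p}\<close> by 2 + 1 - 1, and maximality absorbs \<open>p\<close>.\<close>

lemma maximal_line_parallel_closed:
  assumes M: "matroid M" and F: "F \<in> maximal_lines M" and x: "x \<in> F" "{x} \<in> indeps M"
    and p: "p \<in> ground M" "rk M {x, p} \<le> 1"
  shows "p \<in> F"
proof -
  have "card {x} \<le> rk M (F \<inter> {x, p})" using x by (intro card_indep_le_rk[OF M]) auto
  then have "rk M (F \<union> {x, p}) \<le> 2"
    using rk_submodular[OF M, of F "{x, p}"] p F by (simp add: maximal_lines_def)
  moreover have "F \<union> {x, p} \<subseteq> ground M" using F p(1) x(1) unfolding maximal_lines_def by blast
  ultimately have "F \<union> {x, p} = F" using F unfolding maximal_lines_def by blast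
  then have "{x, p} \<subseteq> F" by (metis Un_upper2)
  then show ?thesis by simp
qed

text \<open>The simplification of \<open>M\<close>, realised by one representative of each parallel class.\<close>

definition simplification :: "'a set_system \<Rightarrow> 'a set \<Rightarrow> bool" where
  "simplification M P \<longleftrightarrow> P \<subseteq> ground M \<and> (\<forall>X \<subseteq> P. card X \<le> 2 \<longrightarrow> X \<in> indeps M) \<and>
     (\<forall>x. {x} \<in> indeps M \<longrightarrow> (\<exists>p\<in>P. rk M {x, p} \<le> 1))"

text \<open>A maximal set without loops and parallel pairs works: a non-loop that cannot be added
  forms a dependent pair with some point of the set.\<close>

lemma simplification_exists:
  assumes M: "matroid M"
  obtains P where "simplification M P"
proof -
  let ?S = "{P. P \<subseteq> ground M \<and> (\<forall>X \<subseteq> P. card X \<le> 2 \<longrightarrow> X \<in> indeps M)}"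
  have "finite ?S" using matroid_finite_ground[OF M] by simp
  moreover have "{} \<in> ?S" using matroid_empty_indep[OF M] by simp
  ultimately obtain P where P: "P \<in> ?S" "\<And>G. G \<in> ?S \<Longrightarrow> P \<subseteq> G \<Longrightarrow> G = P"
    by (metis (no_types, lifting) finite_has_maximal2)
  have finP: "finite P" using P(1) matroid_finite_ground[OF M] finite_subset by blast
  have "\<exists>p\<in>P. rk M {x, p} \<le> 1" if x: "{x} \<in> indeps M" for x
  proof (cases "x \<in> P")
    case True
    then show ?thesis using rk_le_card[OF M, of "{x}"] by (intro bexI[of _ x]) auto
  next
    case False
    then have "insert x P \<notin> ?S" using P(2)[of "insert x P"] by blast
    moreover have "insert x P \<subseteq> ground M" using P(1) matroid_indep_ground[OF M x] by simp
    ultimately obtain X where X: "X \<subseteq> insert x P" "card X \<le> 2" "X \<notin> indeps M" by blast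
    have finX: "finite X" using X finP by (meson finite_insert finite_subset)
    have "x \<in> X" using X P(1) by blast
    then have "card (X - {x}) \<le> 1" using X finX by simp
    then have "card (X - {x}) = 0 \<or> card (X - {x}) = 1" by linarith
    then consider "X - {x} = {}" | p where "X - {x} = {p}"
      using finX by (metis card_0_eq card_1_singletonE finite_Diff)
    then show ?thesis
    proof cases
      case 1
      then have "X = {x}" using \<open>x \<in> X\<close> by blast
      then show ?thesis using X x by simp
    next
      case (2 p)
      then have Xp: "X = {x, p}" "p \<in> P" "x \<noteq> p" using \<open>x \<in> X\<close> X by auto
      have "rk M X \<noteq> 2" using rk_eq_card_iff[OF M finX] X Xp by auto
      moreover have "rk M X \<le> 2" using rk_le_card[OF M finX] X by simp
      ultimately show ?thesis using Xp by (intro bexI[of _ p]) auto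
    qed
  qed
  then show ?thesis using that[of P] P(1) by (simp add: simplification_def)
qed

lemma simplification_finite: "matroid M \<Longrightarrow> simplification M P \<Longrightarrow> finite P"
  unfolding simplification_def by (rule finite_subset[OF conjunct1 matroid_finite_ground])

lemma simplification_pair:
  assumes "simplification M P" "x \<in> P" "y \<in> P"
  shows "{x, y} \<in> indeps M"
proof -
  have "card {x, y} \<le> 2" by (simp add: card_insert_if)
  then show ?thesis using assms by (simp add: simplification_def)
qed

definition lines_on :: "'a set_system \<Rightarrow> 'a set \<Rightarrow> 'a set set" where
  "lines_on M P = (\<lambda>F. F \<inter> P) ` maximal_lines M"

lemma maximal_lines_meet_simplification:
  assumes M: "matroid M" and P: "simplification M P"
    and FG: "F \<in> maximal_lines M" "G \<in> maximal_lines M"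
    and xy: "x \<in> P" "y \<in> P" "x \<noteq> y" "{x, y} \<subseteq> F \<inter> G"
  shows "F = G"
proof (rule maximal_lines_meet[OF M FG])
  have "card {x, y} \<le> rk M (F \<inter> G)"
    using card_indep_le_rk[OF M simplification_pair[OF P xy(1,2)] xy(4)] .
  then show "2 \<le> rk M (F \<inter> G)" using xy by simp
qed

lemma partial_linear_space_lines_on:
  assumes M: "matroid M" and P: "simplification M P"
  shows "partial_linear_space P (lines_on M P)"
proof
  show "finite P" by (rule simplification_finite[OF M P])
  show "L \<subseteq> P" if "L \<in> lines_on M P" for L using that by (auto simp: lines_on_def)
  fix L L' x y
  assume L: "L \<in> lines_on M P" "L' \<in> lines_on M P" "x \<in> L \<inter> L'" "y \<in> L \<inter> L'" "x \<noteq> y"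
  then obtain F G where FG: "F \<in> maximal_lines M" "G \<in> maximal_lines M" "L = F \<inter> P" "L' = G \<inter> P"
    by (auto simp: lines_on_def)
  then show "L = L'" using L maximal_lines_meet_simplification[OF M P FG(1,2), of x y] by auto
qed

text \<open>The bridge from matroid to incidence geometry: a triple is dependent exactly when its
  rank is at most 2, and then it extends to a maximal line.\<close>

lemma dependent_iff_collinear:
  assumes M: "matroid M" and P: "simplification M P" and X: "X \<subseteq> P" "card X = 3"
  shows "X \<notin> indeps M \<longleftrightarrow> (\<exists>L\<in>lines_on M P. X \<subseteq> L)"
proof -
  have finX: "finite X" using X by (simp add: card_ge_0_finite)
  have XE: "X \<subseteq> ground M" using X P by (auto simp: simplification_def)
  show ?thesis
  proof
    assume "X \<notin> indeps M"
    then have "rk M X \<noteq> 3" "rk M X \<le> 3"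
      using rk_eq_card_iff[OF M finX] rk_le_card[OF M finX] X by auto
    then obtain F where "F \<in> maximal_lines M" "X \<subseteq> F" using maximal_line_extend[OF M XE] by force
    then show "\<exists>L\<in>lines_on M P. X \<subseteq> L" using X by (auto simp: lines_on_def)
  next
    assume "\<exists>L\<in>lines_on M P. X \<subseteq> L"
    then obtain F where F: "F \<in> maximal_lines M" "X \<subseteq> F" by (auto simp: lines_on_def)
    then have "rk M X \<le> 2" using rk_mono[OF M F(2)] by (simp add: maximal_lines_def)
    then show "X \<notin> indeps M" using rk_eq_card_iff[OF M finX] X by auto
  qed
qed

lemma collinear_triples_lines_on:
  assumes M: "matroid M" and P: "simplification M P" and S: "S \<subseteq> P"
  shows "collinear_triples (lines_on M P) S = {X. X \<subseteq> S \<and> card X = 3 \<and> X \<notin> indeps M}"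
proof (rule set_eqI)
  fix X
  have "X \<subseteq> S \<Longrightarrow> X \<subseteq> P" using S by simp
  then show "X \<in> collinear_triples (lines_on M P) S \<longleftrightarrow> X \<in> {X. X \<subseteq> S \<and> card X = 3 \<and> X \<notin> indeps M}"
    using dependent_iff_collinear[OF M P, of X] unfolding collinear_triples_def mem_Collect_eq by argo
qed

section \<open>Covers as certificates of dependence\<close>

text \<open>A pair \<open>(F, k)\<close> certifies that any set with more than \<open>k\<close>
  elements in \<open>F\<close> is dependent, since an independent set meets \<open>F\<close> in at
  most \<open>rk M F\<close> elements.\<close>

definition bounds_rank :: "'a set_system \<Rightarrow> ('a set \<times> nat) set \<Rightarrow> bool" where
  "bounds_rank M \<F> \<longleftrightarrow> (\<forall>(F, k)\<in>\<F>. F \<subseteq> ground M \<and> rk M F \<le> k)"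

definition covered :: "('a set \<times> nat) set \<Rightarrow> 'a set \<Rightarrow> bool" where
  "covered \<F> X \<longleftrightarrow> (\<exists>(F, k)\<in>\<F>. k < card (X \<inter> F))"

text \<open>Submodularity for \<open>{x, u}\<close> and \<open>{x, v}\<close>, whose intersection
  contains the non-loop \<open>x\<close>, shows that being parallel is transitive.\<close>

lemma parallel_class_rk:
  assumes M: "matroid M" and x: "{x} \<in> indeps M"
  shows "rk M {y \<in> ground M. rk M {x, y} \<le> 1} \<le> 1"
proof (rule rk_le_iff[OF M, THEN iffD2], intro ballI impI)
  fix X assume X: "X \<in> indeps M" "X \<subseteq> {y \<in> ground M. rk M {x, y} \<le> 1}"
  show "card X \<le> 1"
  proof (rule ccontr)
    assume "\<not> card X \<le> 1"
    then obtain u v where uv: "u \<in> X" "v \<in> X" "u \<noteq> v"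
      using matroid_finite_indep[OF M X(1)] by (metis One_nat_def card_le_Suc0_iff_eq)
    have "rk M {x} = 1" using rk_eq_card_iff[OF M, of "{x}"] x by simp
    moreover have "rk M {x} \<le> rk M ({x, u} \<inter> {x, v})" by (rule rk_mono[OF M]) auto
    moreover have "rk M {x, u} \<le> 1" "rk M {x, v} \<le> 1" using X uv by auto
    ultimately have "rk M ({x, u} \<union> {x, v}) \<le> 1"
      using rk_submodular[OF M, of "{x, u}" "{x, v}"] by linarith
    moreover have "card {u, v} \<le> rk M ({x, u} \<union> {x, v})"
      using uv X(1) by (intro card_indep_le_rk[OF M] matroid_indep_subset[OF M X(1)]) auto
    ultimately show False using uv by simp
  qed
qed

text \<open>A dependent triple contains a loop, or a parallel pair, or else lies on a line and has
  three distinct representatives there. The three kinds of pairs have thresholds 0, 1, 2, the ranks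
  of the loops, of a parallel class and of a line.\<close>

lemma cover_rank_three:
  assumes M: "matroid M" and P: "simplification M P"
  obtains \<F> where "bounds_rank M \<F>" "\<F> \<subseteq> UNIV \<times> {0..2}"
    "card \<F> \<le> 1 + card (ground M) + card {L \<in> lines_on M P. 3 \<le> card L}"
    "\<And>X. X \<subseteq> ground M \<Longrightarrow> card X = 3 \<Longrightarrow> X \<notin> indeps M \<Longrightarrow> covered \<F> X"
proof -
  let ?E = "ground M"
  define cl where "cl x = {y \<in> ?E. rk M {x, y} \<le> 1}" for x
  define A where "A = {(?E - {x. {x} \<in> indeps M}, 0::nat)}"
  define B where "B = (\<lambda>x. (cl x, 1::nat)) ` {x. {x} \<in> indeps M}"
  define G where "G = {F \<in> maximal_lines M. 3 \<le> card (F \<inter> P)}"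
  define C where "C = (\<lambda>F. (F, 2::nat)) ` G"
  have finE: "finite ?E" by (rule matroid_finite_ground[OF M])
  have finP: "finite P" by (rule simplification_finite[OF M P])
  have loops: "rk M (?E - {x. {x} \<in> indeps M}) \<le> 0"
    unfolding rk_le_iff[OF M]
  proof (intro ballI impI)
    fix X assume X: "X \<in> indeps M" "X \<subseteq> ?E - {x. {x} \<in> indeps M}"
    then have "X = {}" using matroid_indep_subset[OF M X(1)] by blast
    then show "card X \<le> 0" by simp
  qed
  have br: "bounds_rank M (A \<union> B \<union> C)"
    using loops parallel_class_rk[OF M]
    by (auto simp: bounds_rank_def A_def B_def C_def cl_def G_def maximal_lines_def)
  have sub: "A \<union> B \<union> C \<subseteq> UNIV \<times> {0..2}" by (auto simp: A_def B_def C_def)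
  have "card B \<le> card {x. {x} \<in> indeps M}"
    unfolding B_def using matroid_indep_ground[OF M] finE
    by (intro card_image_le finite_subset[of "{x. {x} \<in> indeps M}" ?E]) auto
  also have "\<dots> \<le> card ?E" using matroid_indep_ground[OF M] finE by (intro card_mono) auto
  finally have cB: "card B \<le> card ?E" .
  have "inj_on (\<lambda>F. F \<inter> P) G"
  proof (rule inj_onI)
    fix F F' assume F: "F \<in> G" "F' \<in> G" "F \<inter> P = F' \<inter> P"
    then have "\<not> card (F \<inter> P) \<le> Suc 0" by (auto simp: G_def)
    then obtain x y where "x \<in> F \<inter> P" "y \<in> F \<inter> P" "x \<noteq> y"
      using finP by (metis card_le_Suc0_iff_eq finite_Int)
    then show "F = F'" using F maximal_lines_meet_simplification[OF M P, of F F' x y]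
      by (auto simp: G_def)
  qed
  then have "card G = card ((\<lambda>F. F \<inter> P) ` G)" by (rule card_image[symmetric])
  also have "\<dots> \<le> card {L \<in> lines_on M P. 3 \<le> card L}"
    using maximal_lines_finite[OF M] by (intro card_mono) (auto simp: G_def lines_on_def)
  finally have cG: "card G \<le> card {L \<in> lines_on M P. 3 \<le> card L}" .
  have "card C \<le> card G" unfolding C_def
    using maximal_lines_finite[OF M] by (intro card_image_le) (simp add: G_def)
  then have "card (A \<union> B \<union> C) \<le> 1 + card ?E + card {L \<in> lines_on M P. 3 \<le> card L}"
    using cG cB card_Un_le[of "A \<union> B" C] card_Un_le[of A B] by (simp add: A_def)
  moreover have "covered (A \<union> B \<union> C) X"
    if X: "X \<subseteq> ?E" "card X = 3" "X \<notin> indeps M" for X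
  proof -
    have finX: "finite X" using X finE finite_subset by blast
    consider (loop) x where "x \<in> X" "{x} \<notin> indeps M"
      | (parallel) x y where "x \<in> X" "y \<in> X" "x \<noteq> y" "{x} \<in> indeps M" "rk M {x, y} \<le> 1"
      | (simple) "\<forall>x\<in>X. {x} \<in> indeps M" "\<forall>x\<in>X. \<forall>y\<in>X. x \<noteq> y \<longrightarrow> 2 \<le> rk M {x, y}"
      by force
    then show ?thesis
    proof cases
      case loop
      then have "x \<in> X \<inter> (?E - {x. {x} \<in> indeps M})" using X by auto
      then have "0 < card (X \<inter> (?E - {x. {x} \<in> indeps M}))" using finX by (auto simp: card_gt_0_iff)
      then show ?thesis unfolding covered_def A_def by blast
    next
      case parallel
      then have "rk M {x, x} \<le> 1" using rk_le_card[OF M, of "{x}"] by simp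
      then have "{x, y} \<subseteq> X \<inter> cl x" using parallel X by (auto simp: cl_def)
      then have "card {x, y} \<le> card (X \<inter> cl x)" using finX by (intro card_mono) auto
      then have "1 < card (X \<inter> cl x)" using parallel by simp
      moreover have "(cl x, 1) \<in> A \<union> B \<union> C" using parallel by (auto simp: B_def)
      ultimately show ?thesis unfolding covered_def by blast
    next
      case simple
      have "rk M X \<noteq> 3" "rk M X \<le> 3"
        using rk_eq_card_iff[OF M finX] rk_le_card[OF M finX] X by auto
      then obtain F where F: "F \<in> maximal_lines M" "X \<subseteq> F"
        using maximal_line_extend[OF M X(1)] by force
      have "\<forall>x\<in>X. \<exists>p\<in>P. rk M {x, p} \<le> 1" using simple P by (auto simp: simplification_def)
      then obtain p where p: "\<And>x. x \<in> X \<Longrightarrow> p x \<in> P" "\<And>x. x \<in> X \<Longrightarrow> rk M {x, p x} \<le> 1" by metis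
      have "P \<subseteq> ground M" using P by (simp add: simplification_def)
      then have "p x \<in> F" if "x \<in> X" for x
        using maximal_line_parallel_closed[OF M F(1), of x "p x"] p[OF that] that F simple(1) by blast
      then have "p ` X \<subseteq> F \<inter> P" using p by auto
      \<comment> \<open>Two elements with a common representative would be parallel, which this case
        excludes. Hence the trace of \<open>F\<close> on \<open>P\<close> has three points and
        \<open>F\<close> belongs to \<open>G\<close>.\<close>
      moreover have "inj_on p X"
      proof (rule inj_onI, rule ccontr)
        fix x y assume xy: "x \<in> X" "y \<in> X" "p x = p y" "x \<noteq> y"
        have "{p x} \<in> indeps M" using simplification_pair[OF P, of "p x" "p x"] p xy by simp
        then have "rk M {p x} = 1" using rk_eq_card_iff[OF M, of "{p x}"] by simp
        moreover have "rk M {p x} \<le> rk M ({x, p x} \<inter> {y, p x})" by (rule rk_mono[OF M]) auto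
        ultimately have "rk M ({x, p x} \<union> {y, p x}) \<le> 1"
          using rk_submodular[OF M, of "{x, p x}" "{y, p x}"] p(2)[OF xy(1)] p(2)[OF xy(2)] xy(3) by simp
        moreover have "rk M {x, y} \<le> rk M ({x, p x} \<union> {y, p x})" by (rule rk_mono[OF M]) auto
        ultimately show False using simple xy by fastforce
      qed
      ultimately have "3 \<le> card (F \<inter> P)"
        using card_inj_on_le[of p X "F \<inter> P"] finP X by simp
      then have "(F, 2) \<in> A \<union> B \<union> C" using F by (auto simp: C_def G_def)
      moreover have "2 < card (X \<inter> F)" using F X by (simp add: Int_absorb2)
      ultimately show ?thesis unfolding covered_def by blast
    qed
  qed
  ultimately show ?thesis using that br sub by blast
qed

section \<open>Minors and long lines\<close>

lemma basis_of_indep_iff: "C \<in> indeps M \<Longrightarrow> basis_of M C B \<longleftrightarrow> B = C"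
  unfolding basis_of_def by (metis order_refl subset_antisym)

lemma contract_indep:
  assumes "C \<in> indeps M"
  shows "contract M C = (ground M - C, {X. X \<subseteq> ground M - C \<and> X \<union> C \<in> indeps M})"
  by (simp add: contract_def basis_of_indep_iff[OF assms])

lemma contract_empty:
  assumes "matroid M"
  shows "contract M {} = M"
  using matroid_indep_ground[OF assms]
  by (auto simp: contract_indep[OF matroid_empty_indep[OF assms]] prod_eq_iff)

lemma is_minor_delete:
  assumes "matroid M"
  shows "is_minor (delete M (ground M - S)) M"
  unfolding is_minor_def
  by (intro exI[of _ "{}"] exI[of _ "ground M - S"]) (simp add: contract_empty[OF assms])

lemma basis_of_contract:
  assumes M: "matroid M" and S: "S \<in> indeps M" and B: "basis_of (contract M S) C B"
  shows "basis_of M (S \<union> C) (S \<union> B)"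
proof -
  have ind: "X \<in> indeps (contract M S) \<longleftrightarrow> X \<subseteq> ground M - S \<and> X \<union> S \<in> indeps M" for X
    by (simp add: contract_indep[OF S])
  have B1: "B \<subseteq> ground M - S" "B \<union> S \<in> indeps M" "B \<subseteq> C"
    using B unfolding basis_of_def ind by auto
  have "B' = S \<union> B" if B': "B' \<in> indeps M" "S \<union> B \<subseteq> B'" "B' \<subseteq> S \<union> C" for B'
  proof -
    have "B' - S \<subseteq> ground M - S" using matroid_indep_ground[OF M B'(1)] by blast
    moreover have "(B' - S) \<union> S = B'" using B'(2) by blast
    ultimately have "B' - S \<in> indeps (contract M S)" using B'(1) by (simp add: ind)
    moreover have "B \<subseteq> B' - S" "B' - S \<subseteq> C" using B' B1 by auto
    ultimately have "B' - S = B" using B unfolding basis_of_def by metis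
    then show ?thesis using B'(2) by auto
  qed
  moreover have "S \<union> B \<in> indeps M" using B1(2) by (simp add: Un_commute)
  moreover have "S \<union> B \<subseteq> S \<union> C" using B1(3) by auto
  ultimately show ?thesis unfolding basis_of_def by blast
qed

text \<open>Adding \<open>S\<close> to a basis of \<open>C\<close> in the contraction gives a basis
  of \<open>S \<union> C\<close>; by \<open>contract_basis_irrelevant\<close> the right-hand side
  may be computed with that basis.\<close>

lemma contract_contract:
  assumes M: "matroid M" and S: "S \<in> indeps M"
  shows "contract (contract M S) C = contract M (S \<union> C)"
proof -
  have g: "ground (contract M S) = ground M - S" by (simp add: contract_def)
  have ind: "X \<in> indeps (contract M S) \<longleftrightarrow> X \<subseteq> ground M - S \<and> X \<union> S \<in> indeps M" for X
    by (simp add: contract_indep[OF S])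
  obtain B where B: "basis_of (contract M S) C B"
    using basis_of_exists[OF matroid_contract[OF M]] by blast
  have BS: "B \<subseteq> ground M - S" using B unfolding basis_of_def ind by auto
  note SB = basis_of_contract[OF M S B]
  have "X \<in> indeps (contract (contract M S) C) \<longleftrightarrow> X \<in> indeps (contract M (S \<union> C))" for X
  proof
    assume "X \<in> indeps (contract (contract M S) C)"
    then obtain B' where B': "X \<subseteq> ground M - S - C" "basis_of (contract M S) C B'"
        "X \<union> B' \<union> S \<in> indeps M"
      by (auto simp: contract_def[of "contract M S"] g ind)
    then have "basis_of M (S \<union> C) (S \<union> B')" "X \<union> (S \<union> B') \<in> indeps M"
      using basis_of_contract[OF M S B'(2)] by (simp_all add: Un_ac)
    then show "X \<in> indeps (contract M (S \<union> C))"
      using B'(1) by (auto simp: contract_def[of M "S \<union> C"])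
  next
    assume "X \<in> indeps (contract M (S \<union> C))"
    then obtain B' where B': "X \<subseteq> ground M - (S \<union> C)" "basis_of M (S \<union> C) B'" "X \<union> B' \<in> indeps M"
      by (auto simp: contract_def[of M "S \<union> C"])
    have "X \<inter> (S \<union> C) = {}" using B'(1) by blast
    then have "X \<union> (S \<union> B) \<in> indeps M"
      using contract_basis_irrelevant[OF M B'(2) SB _ B'(3)] by blast
    then have "X \<union> B \<union> S \<in> indeps M" by (simp add: Un_ac)
    moreover have "X \<union> B \<subseteq> ground M - S" using B'(1) BS by blast
    ultimately have "X \<union> B \<in> indeps (contract M S)" by (simp add: ind)
    then show "X \<in> indeps (contract (contract M S) C)"
      using B'(1) B by (auto simp: contract_def[of "contract M S"] g)
  qed
  moreover have "ground (contract (contract M S) C) = ground (contract M (S \<union> C))"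
    by (auto simp: contract_def)
  ultimately show ?thesis by (simp add: prod_eq_iff set_eq_iff)
qed

text \<open>This passes the exclusion of \<open>N\<close> on to the rank-three contractions.\<close>

lemma is_minor_contract:
  assumes M: "matroid M" and S: "S \<in> indeps M" and N: "is_minor N (contract M S)"
  shows "is_minor N M"
proof -
  have g: "ground (contract M S) = ground M - S" by (simp add: contract_def)
  obtain C D where CD: "C \<subseteq> ground M - S" "D \<subseteq> ground M - S" "C \<inter> D = {}"
      "N = delete (contract (contract M S) C) D"
    using N unfolding is_minor_def g by blast
  have "S \<union> C \<subseteq> ground M" "D \<subseteq> ground M" "(S \<union> C) \<inter> D = {}"
    using CD matroid_indep_ground[OF M S] by auto
  then show ?thesis
    using CD(4) unfolding is_minor_def contract_contract[OF M S] by blast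
qed

section \<open>Six-element restrictions isomorphic to the excluded matroid\<close>

lemma bij_betw_disjoint_union:
  assumes "bij_betw f A B" "bij_betw g A' B'" "A \<inter> A' = {}" "B \<inter> B' = {}"
  obtains h where "bij_betw h (A \<union> A') (B \<union> B')"
    "\<And>X. X \<subseteq> A \<Longrightarrow> h ` X = f ` X" "\<And>X. X \<subseteq> A' \<Longrightarrow> h ` X = g ` X"
proof -
  define h where "h x = (if x \<in> A then f x else g x)" for x
  have hf: "h x = f x" if "x \<in> A" for x using that by (simp add: h_def)
  have hg: "h x = g x" if "x \<in> A'" for x using that assms(3) by (auto simp: h_def)
  have "bij_betw h A B" using assms(1) hf by (simp cong: bij_betw_cong)
  moreover have "bij_betw h A' B'" using assms(2) hg by (simp cong: bij_betw_cong)
  ultimately have "bij_betw h (A \<union> A') (B \<union> B')" using assms(4) by (rule bij_betw_combine)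
  moreover have "h ` X = f ` X" if "X \<subseteq> A" for X using that hf by (intro image_cong) auto
  moreover have "h ` X = g ` X" if "X \<subseteq> A'" for X using that hg by (intro image_cong) auto
  ultimately show ?thesis by (rule that)
qed

lemma bij_betw_subset_to_subset:
  assumes "finite S" "finite T" "card S = card T" "X \<subseteq> S" "Y \<subseteq> T" "card X = card Y"
  obtains f where "bij_betw f S T" "f ` X = Y" "f ` (S - X) = T - Y"
proof -
  have fin: "finite X" "finite Y" using assms finite_subset by auto
  obtain f where f: "bij_betw f X Y"
    using finite_same_card_bij[OF fin assms(6)] by blast
  have "card (S - X) = card (T - Y)" using assms fin by (simp add: card_Diff_subset)
  then obtain g where g: "bij_betw g (S - X) (T - Y)"
    using finite_same_card_bij[of "S - X" "T - Y"] assms by auto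
  obtain h where h: "bij_betw h (X \<union> (S - X)) (Y \<union> (T - Y))" "\<And>Z. Z \<subseteq> X \<Longrightarrow> h ` Z = f ` Z"
      "\<And>Z. Z \<subseteq> S - X \<Longrightarrow> h ` Z = g ` Z"
    using bij_betw_disjoint_union[OF f g] by auto
  have "X \<union> (S - X) = S" "Y \<union> (T - Y) = T" using assms by auto
  then show ?thesis
    using that[of h] h f g by (simp add: bij_betw_def)
qed

definition dependent_triples :: "'a set_system \<Rightarrow> 'a set \<Rightarrow> 'a set set" where
  "dependent_triples M S = {X. X \<subseteq> S \<and> card X = 3 \<and> X \<notin> indeps M}"

text \<open>On points of a simplification all sets of size at most 2 are independent, and by the
  rank bound none of size above 3 is, so only the triples have to be compared.\<close>

lemma isomorphic_rank3_on_six: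
  assumes M: "matroid M" and rank: "\<And>X. X \<in> indeps M \<Longrightarrow> card X \<le> 3"
    and P: "simplification M P" "S \<subseteq> P" and f: "bij_betw f S {1..6}"
    and L: "(`) f ` dependent_triples M S = L"
  shows "isomorphic (delete M (ground M - S)) (rank3_on_six L)"
  unfolding isomorphic_def
proof (intro exI[of _ f] conjI allI impI)
  have SE: "S \<subseteq> ground M" using P by (auto simp: simplification_def)
  then have g: "ground (delete M (ground M - S)) = S" by (auto simp: delete_def)
  then show "bij_betw f (ground (delete M (ground M - S))) (ground (rank3_on_six L))"
    using f by (simp add: rank3_on_six_def)
  fix X assume "X \<subseteq> ground (delete M (ground M - S))"
  then have X: "X \<subseteq> S" using g by simp
  have inj: "inj_on f S" and im: "f ` S = {1..6}" using f by (auto simp: bij_betw_def)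
  have cX: "card (f ` X) = card X" using inj X by (meson card_image inj_on_subset)
  have fX: "f ` X \<in> L \<longleftrightarrow> X \<in> dependent_triples M S"
  proof
    assume "f ` X \<in> L"
    then obtain Y where Y: "Y \<in> dependent_triples M S" "f ` X = f ` Y" using L by auto
    then have "Y \<subseteq> S" by (simp add: dependent_triples_def)
    then have "X = Y" using inj_on_image_eq_iff[OF inj X] Y(2) by blast
    then show "X \<in> dependent_triples M S" using Y(1) by simp
  next
    assume "X \<in> dependent_triples M S"
    then show "f ` X \<in> L" using L by auto
  qed
  have "X \<in> indeps M \<longleftrightarrow> card X \<le> 3 \<and> X \<notin> dependent_triples M S"
  proof
    assume "X \<in> indeps M"
    then show "card X \<le> 3 \<and> X \<notin> dependent_triples M S"
      using rank by (simp add: dependent_triples_def)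
  next
    assume *: "card X \<le> 3 \<and> X \<notin> dependent_triples M S"
    show "X \<in> indeps M"
    proof (cases "card X \<le> 2")
      case True
      then show ?thesis using P X by (simp add: simplification_def)
    next
      case False
      then show ?thesis using * X by (simp add: dependent_triples_def)
    qed
  qed
  moreover have "X \<inter> (ground M - S) = {}" using X by auto
  moreover have "f ` X \<subseteq> {1..6}" using X im by blast
  ultimately show "X \<in> indeps (delete M (ground M - S)) \<longleftrightarrow> f ` X \<in> indeps (rank3_on_six L)"
    by (simp add: delete_def rank3_on_six_def cX fX)
qed

lemma uniform_matroid_3_6: "uniform_matroid 3 6 = rank3_on_six {}"
  by (simp add: uniform_matroid_def rank3_on_six_def)

lemma thick_restriction_contains:
  assumes M: "matroid M" and rank: "\<And>X. X \<in> indeps M \<Longrightarrow> card X \<le> 3"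
    and P: "simplification M P" "Q \<subseteq> P"
    and thick: "thick_linear_space Q ((\<lambda>L. L \<inter> Q) ` {L \<in> lines_on M P. 3 \<le> card (L \<inter> Q)})"
    and N: "N = uniform_matroid 3 6 \<or> N = P6 \<or> N = Q6 \<or> N = R6"
  shows "\<exists>S. isomorphic (delete M (ground M - S)) N"
proof -
  define \<L> where "\<L> = (\<lambda>L. L \<inter> Q) ` {L \<in> lines_on M P. 3 \<le> card (L \<inter> Q)}"
  interpret thick_linear_space Q \<L> using thick by (simp add: \<L>_def)
  have ct: "collinear_triples \<L> S = dependent_triples M S" if "S \<subseteq> Q" for S
    using collinear_triples_restrict[OF that finite_points] that P(2)
      collinear_triples_lines_on[OF M P(1), of S]
    by (simp add: \<L>_def dependent_triples_def)
  have iso: "isomorphic (delete M (ground M - S)) (rank3_on_six L)"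
    if "S \<subseteq> Q" "bij_betw f S {1..6}" "(`) f ` dependent_triples M S = L" for S f L
    using isomorphic_rank3_on_six[OF M rank P(1) _ that(2,3)] that(1) P(2) by blast
  have fin: "finite S" if "S \<subseteq> Q" for S using that finite_points finite_subset by blast
  have c3: "X \<subseteq> S \<and> card X = 3" if "X \<in> dependent_triples M S" for X S
    using that by (simp add: dependent_triples_def)
  consider (U) "N = rank3_on_six {}" | (P) "N = rank3_on_six {{1,2,3}}"
    | (Q) "N = rank3_on_six {{1,2,3},{1,4,5}}" | (R) "N = rank3_on_six {{1,2,3},{4,5,6}}"
    using N by (auto simp: uniform_matroid_3_6 P6_def Q6_def R6_def)
  then show ?thesis
  proof cases
    case U
    obtain S where S: "S \<subseteq> Q" "card S = 6" "dependent_triples M S = {}"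
      using six_points_no_line ct by metis
    then obtain f where "bij_betw f S {1..6::nat}"
      using finite_same_card_bij[of S "{1..6::nat}"] fin by auto
    then show ?thesis using iso[OF S(1), of f "{}"] S(3) U by auto
  next
    case P
    obtain S X where S: "S \<subseteq> Q" "card S = 6" "dependent_triples M S = {X}"
      using six_points_one_line ct by metis
    have X: "X \<subseteq> S" "card X = 3" using c3[of X S] S(3) by auto
    obtain f where f: "bij_betw f S {1..6::nat}" "f ` X = {1,2,3}" "f ` (S - X) = {1..6} - {1,2,3}"
      by (rule bij_betw_subset_to_subset[of S "{1..6::nat}" X "{1,2,3}"])
        (use fin[OF S(1)] S(2) X in simp_all)
    then show ?thesis using iso[OF S(1) f(1), of "{{1,2,3}}"] S(3) P by auto
  next
    case R
    obtain X Y where XY: "X \<union> Y \<subseteq> Q" "card X = 3" "card Y = 3" "X \<inter> Y = {}"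
        "dependent_triples M (X \<union> Y) = {X, Y}"
      using two_disjoint_lines ct by metis
    have fXY: "finite (X \<union> Y)" by (rule fin[OF XY(1)])
    then have c6: "card (X \<union> Y) = 6" using XY by (simp add: card_Un_disjoint)
    obtain f where f: "bij_betw f (X \<union> Y) {1..6::nat}" "f ` X = {1,2,3}"
        "f ` (X \<union> Y - X) = {1..6} - {1,2,3}"
      by (rule bij_betw_subset_to_subset[of "X \<union> Y" "{1..6::nat}" X "{1,2,3}"])
        (use fXY c6 XY(2) in simp_all)
    have "X \<union> Y - X = Y" using XY(4) by auto
    moreover have "{1..6} - {1,2,3} = {4,5,6::nat}" by auto
    ultimately have "f ` Y = {4,5,6}" using f(3) by simp
    then show ?thesis using iso[OF XY(1) f(1), of "{{1,2,3},{4,5,6}}"] XY(5) R f(2) by auto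
  next
    case Q
    obtain S X Y a where S: "S \<subseteq> Q" "card S = 6" "X \<inter> Y = {a}" "dependent_triples M S = {X, Y}"
      using six_points_two_meeting_lines ct by metis
    have X: "X \<subseteq> S" "card X = 3" and Y: "Y \<subseteq> S" "card Y = 3" using c3[of _ S] S(4) by auto
    have fS: "finite S" "finite X" "finite Y" using fin[OF S(1)] X Y finite_subset by auto
    have a: "a \<in> X" "a \<in> Y" using S(3) by auto
    \<comment> \<open>The labelling of \<open>Q6\<close> is glued from two parts: \<open>f\<close>
      sends \<open>a\<close> to 1 and the rest of \<open>X\<close> to 2 and 3, while
      \<open>g\<close> sends the rest of \<open>Y\<close> to 4 and 5 and the sixth point to
      6.\<close>
    obtain f where f: "bij_betw f X {1,2,3::nat}" "f ` {a} = {1}" "f ` (X - {a}) = {1,2,3} - {1}"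
      by (rule bij_betw_subset_to_subset[of X "{1,2,3::nat}" "{a}" "{1}"])
        (use fS X a in simp_all)
    have Ya: "Y - {a} \<subseteq> S - X" using Y(1) S(3) by auto
    have "card (Y - {a}) = 2" "card (S - X) = 3" using Y X a S(2) fS by (auto simp: card_Diff_subset)
    note c = this
    obtain g where g: "bij_betw g (S - X) {4,5,6::nat}" "g ` (Y - {a}) = {4,5}"
        "g ` (S - X - (Y - {a})) = {4,5,6} - {4,5}"
      by (rule bij_betw_subset_to_subset[of "S - X" "{4,5,6::nat}" "Y - {a}" "{4,5}"])
        (use fS Ya c in simp_all)
    obtain h where h: "bij_betw h (X \<union> (S - X)) ({1,2,3} \<union> {4,5,6})"
        "\<And>Z. Z \<subseteq> X \<Longrightarrow> h ` Z = f ` Z" "\<And>Z. Z \<subseteq> S - X \<Longrightarrow> h ` Z = g ` Z"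
      using bij_betw_disjoint_union[OF f(1) g(1)] by auto
    have "X \<union> (S - X) = S" using X by auto
    moreover have "{1,2,3} \<union> {4,5,6} = {1..6::nat}" by auto
    ultimately have hS: "bij_betw h S {1..6}" using h(1) by simp
    have "h ` X = {1,2,3}" using h(2)[of X] f(1) by (simp add: bij_betw_def)
    moreover have "Y = {a} \<union> (Y - {a})" using a by auto
    then have "h ` Y = h ` {a} \<union> h ` (Y - {a})" by (metis image_Un)
    then have "h ` Y = {1,4,5}" using h(2)[of "{a}"] h(3)[OF Ya] f(2) g(2) a by auto
    ultimately show ?thesis using iso[OF S(1) hS, of "{{1,2,3},{1,4,5}}"] S(4) Q by auto
  qed
qed

lemma card_long_lines_excluding_six:
  assumes M: "matroid M" and rank: "\<And>X. X \<in> indeps M \<Longrightarrow> card X \<le> 3"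
    and P: "simplification M P"
    and N: "N = uniform_matroid 3 6 \<or> N = P6 \<or> N = Q6 \<or> N = R6"
    and excl: "\<And>M'. is_minor M' M \<Longrightarrow> \<not> isomorphic M' N"
  shows "card {L \<in> lines_on M P. 3 \<le> card L} \<le> 600 * card P"
proof (rule ccontr)
  assume "\<not> ?thesis"
  then have "600 * card P < card {L \<in> lines_on M P. 3 \<le> card L}" by simp
  then obtain Q where "Q \<subseteq> P"
      "thick_linear_space Q ((\<lambda>L. L \<inter> Q) ` {L \<in> lines_on M P. 3 \<le> card (L \<inter> Q)})"
    using thick_restriction[OF partial_linear_space_lines_on[OF M P]] by blast
  then show False
    using thick_restriction_contains[OF M rank P _ _ N] excl is_minor_delete[OF M] by blast
qed

section \<open>Excluding a rank-two uniform minor\<close>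

text \<open>The long lines through \<open>e\<close> become distinct parallel classes of the
  contraction of \<open>e\<close>, which has rank at most 2; choosing one further point from each
  line leaves a uniform matroid.\<close>

lemma isomorphic_uniform_two:
  assumes M: "matroid M" and rank: "\<And>X. X \<in> indeps M \<Longrightarrow> card X \<le> 3"
    and P: "simplification M P" and e: "e \<in> P"
    and T: "finite T" "T \<subseteq> {L \<in> lines_on M P. 3 \<le> card L \<and> e \<in> L}"
  shows "\<exists>S. isomorphic (delete (contract M {e}) (ground M - {e} - S)) (uniform_matroid 2 (card T))"
proof -
  interpret partial_linear_space P "lines_on M P" by (rule partial_linear_space_lines_on[OF M P])
  have PE: "P \<subseteq> ground M" using P by (simp add: simplification_def)
  have e1: "{e} \<in> indeps M" using simplification_pair[OF P e e] by simp
  have "\<exists>x. x \<in> L - {e}" if "L \<in> T" for L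
  proof (rule ccontr)
    assume "\<nexists>x. x \<in> L - {e}"
    then have "L \<subseteq> {e}" by blast
    then have "card L \<le> 1" using card_mono[of "{e}" L] by simp
    then show False using that T by auto
  qed
  then obtain g where g: "\<And>L. L \<in> T \<Longrightarrow> g L \<in> L - {e}" by metis
  have TL: "L \<in> lines_on M P" "e \<in> L" "L \<subseteq> P" if "L \<in> T" for L
    using that T line_subset by auto
  have inj: "inj_on g T"
  proof (rule inj_onI)
    fix L L' assume L: "L \<in> T" "L' \<in> T" "g L = g L'"
    then show "L = L'" using line_unique[of L L' e "g L"] g[of L] g[of L'] TL[of L] TL[of L'] by auto
  qed
  define S where "S = g ` T"
  have SP: "S \<subseteq> P - {e}" using g TL by (fastforce simp: S_def)
  have "card S = card T" using inj by (simp add: S_def card_image)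
  then obtain f where f: "bij_betw f S {1..card T}"
    using finite_same_card_bij[of S "{1..card T}"] T by (auto simp: S_def)
  have "isomorphic (delete (contract M {e}) (ground M - {e} - S)) (uniform_matroid 2 (card T))"
    unfolding isomorphic_def
  proof (intro exI[of _ f] conjI allI impI)
    let ?D = "delete (contract M {e}) (ground M - {e} - S)"
    have g1: "ground ?D = S" using SP PE by (auto simp: delete_def contract_def)
    then show "bij_betw f (ground ?D) (ground (uniform_matroid 2 (card T)))"
      using f by (simp add: uniform_matroid_def)
    fix X assume "X \<subseteq> ground ?D"
    then have X: "X \<subseteq> S" using g1 by simp
    have finX: "finite X" using X T by (auto simp: S_def intro: finite_subset)
    have eX: "e \<notin> X" using X SP by auto
    have "f ` X \<subseteq> {1..card T}" using X f by (auto simp: bij_betw_def)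
    moreover have "card (f ` X) = card X" using X f by (meson bij_betw_def card_image inj_on_subset)
    ultimately have 1: "f ` X \<in> indeps (uniform_matroid 2 (card T)) \<longleftrightarrow> card X \<le> 2"
      by (simp add: uniform_matroid_def)
    have "X \<subseteq> ground M - {e}" "X \<inter> (ground M - {e} - S) = {}" using X SP PE by auto
    then have 2: "X \<in> indeps ?D \<longleftrightarrow> insert e X \<in> indeps M"
      by (simp add: delete_def contract_indep[OF e1])
    have "insert e X \<in> indeps M \<longleftrightarrow> card X \<le> 2"
    proof
      assume "insert e X \<in> indeps M"
      then have "card (insert e X) \<le> 3" by (rule rank)
      then show "card X \<le> 2" using finX eX by simp
    next
      assume c: "card X \<le> 2"
      have iP: "insert e X \<subseteq> P" using X SP e by auto
      show "insert e X \<in> indeps M"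
      proof (cases "card X = 2")
        case False
        then have "card (insert e X) \<le> 2" using c finX eX by simp
        then show ?thesis using P iP by (simp add: simplification_def)
      next
        case True
        then obtain u v where uv: "X = {u, v}" "u \<noteq> v" by (auto simp: card_2_iff)
        then obtain L L' where L: "L \<in> T" "L' \<in> T" "u = g L" "v = g L'" using X by (auto simp: S_def)
        \<comment> \<open>If \<open>e\<close>, \<open>u\<close>, \<open>v\<close> were collinear on
          \<open>K\<close>, then \<open>K\<close> would share two points with each of the two chosen
          lines, and these would coincide.\<close>
        show ?thesis
        proof (rule ccontr)
          assume "insert e X \<notin> indeps M"
          moreover have "card (insert e X) = 3" using True finX eX by simp
          ultimately obtain K where K: "K \<in> lines_on M P" "insert e X \<subseteq> K"
            using dependent_iff_collinear[OF M P iP] by blast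
          have "L = K" using line_unique[of L K e u] K uv g[OF L(1)] TL[OF L(1)] L(3) by auto
          moreover have "L' = K" using line_unique[of L' K e v] K uv g[OF L(2)] TL[OF L(2)] L(4) by auto
          ultimately show False using L uv by simp
        qed
      qed
    qed
    then show "X \<in> indeps ?D \<longleftrightarrow> f ` X \<in> indeps (uniform_matroid 2 (card T))"
      using 1 2 by simp
  qed
  then show ?thesis by blast
qed

text \<open>Every long line has a point, so the degrees of the points sum to at least the number of
  long lines; a point on more than \<open>k\<close> of them would yield the excluded minor by
  contraction.\<close>

lemma card_long_lines_excluding_uniform_two:
  assumes M: "matroid M" and rank: "\<And>X. X \<in> indeps M \<Longrightarrow> card X \<le> 3"
    and P: "simplification M P"
    and excl: "\<And>M'. is_minor M' M \<Longrightarrow> \<not> isomorphic M' (uniform_matroid 2 k)"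
  shows "card {L \<in> lines_on M P. 3 \<le> card L} \<le> k * card P"
proof -
  interpret partial_linear_space P "lines_on M P" by (rule partial_linear_space_lines_on[OF M P])
  let ?T = "\<lambda>p. {L \<in> lines_on M P. 3 \<le> card L \<and> p \<in> L}"
  have fin: "finite (?T p)" for p using finite_lines by simp
  have deg: "card (?T p) \<le> k" if p: "p \<in> P" for p
  proof (rule ccontr)
    assume "\<not> card (?T p) \<le> k"
    then have "k \<le> card (?T p)" by simp
    then obtain T where T: "T \<subseteq> ?T p" "card T = k" by (rule obtain_subset_with_card_n)
    then obtain S where "isomorphic (delete (contract M {p}) (ground M - {p} - S)) (uniform_matroid 2 k)"
      using isomorphic_uniform_two[OF M rank P p finite_subset[OF T(1) fin] T(1)] T(2) by blast
    moreover have "is_minor (delete (contract M {p}) (ground M - {p} - S)) M"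
      unfolding is_minor_def
      by (rule exI[of _ "{p}"], rule exI[of _ "ground M - {p} - S"])
        (use p P in \<open>auto simp: simplification_def\<close>)
    ultimately show False using excl by blast
  qed
  have "{L \<in> lines_on M P. 3 \<le> card L} \<subseteq> (\<Union>p\<in>P. ?T p)"
  proof
    fix L assume L: "L \<in> {L \<in> lines_on M P. 3 \<le> card L}"
    then have "L \<noteq> {}" by auto
    then show "L \<in> (\<Union>p\<in>P. ?T p)" using L line_subset[of L] by auto
  qed
  then have "card {L \<in> lines_on M P. 3 \<le> card L} \<le> card (\<Union>p\<in>P. ?T p)"
    using fin finite_points by (intro card_mono) auto
  also have "\<dots> \<le> (\<Sum>p\<in>P. card (?T p))" using finite_points by (rule card_UN_le)
  also have "\<dots> \<le> (\<Sum>p\<in>P. k)" using deg by (intro sum_mono) auto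
  finally show ?thesis by (simp add: mult.commute)
qed

section \<open>Lifting covers from a contraction\<close>

text \<open>If \<open>S\<close> is extended to a basis \<open>B\<close> of
  \<open>F \<union> S\<close>, then \<open>B - S\<close> is independent in the contraction.\<close>

lemma rk_contract:
  assumes M: "matroid M" and S: "S \<in> indeps M" and F: "F \<subseteq> ground M - S"
  shows "rk M (F \<union> S) \<le> rk (contract M S) F + card S"
proof -
  obtain B where B: "basis_of M (F \<union> S) B" "S \<subseteq> B"
    using basis_of_extend[OF M S, of "F \<union> S"] by auto
  have ind: "B \<in> indeps M" "B \<subseteq> F \<union> S" using B(1) by (auto simp: basis_of_def)
  have "(B - S) \<union> S = B" using B(2) by auto
  then have "B - S \<in> indeps (contract M S)" "B - S \<subseteq> F"
    using ind F by (auto simp: contract_indep[OF S])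
  then have "card (B - S) \<le> rk (contract M S) F"
    by (rule card_indep_le_rk[OF matroid_contract[OF M]])
  moreover have "card B = card (B - S) + card S"
    using B(2) matroid_finite_indep[OF M ind(1)]
    by (metis card_Diff_subset card_mono finite_subset le_add_diff_inverse2)
  ultimately show ?thesis using rk_eq_card_basis[OF M B(1)] by simp
qed

lemma card_le_matroid_rank:
  assumes "matroid M" "X \<in> indeps M"
  shows "card X \<le> matroid_rank M"
  unfolding matroid_rank_def using assms matroid_finite_indeps[OF assms(1)] by (intro Max_ge) auto

text \<open>Passing from \<open>(F, k)\<close> to \<open>(F \<union> S, k + card S)\<close> raises
  the threshold by exactly the \<open>card S\<close> elements that \<open>X\<close> gains in the
  set; \<open>rk_contract\<close> keeps the rank bound valid.\<close>

lemma covered_lift_contract: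
  assumes "covered \<F> (X - S)" "S \<subseteq> X" "finite X" "bounds_rank (contract M S) \<F>"
  shows "covered ((\<lambda>(F, k). (F \<union> S, k + card S)) ` \<F>) X"
proof -
  obtain F k where F: "(F, k) \<in> \<F>" "k < card ((X - S) \<inter> F)"
    using assms(1) by (auto simp: covered_def)
  have "card ((X - S) \<inter> F) + card S = card (((X - S) \<inter> F) \<union> S)"
    using assms by (intro card_Un_disjoint[symmetric]) (auto intro: finite_subset)
  also have "\<dots> \<le> card (X \<inter> (F \<union> S))" using assms by (intro card_mono) auto
  finally have "k + card S < card (X \<inter> (F \<union> S))" using F by simp
  then show ?thesis using F unfolding covered_def by force
qed

text \<open>For independent \<open>S\<close> of corank three, the sets above \<open>S\<close> are
  governed by the contraction, whose few long lines give a cover of linear size that is lifted to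
  \<open>M\<close>. The constant depends on \<open>N\<close> only, not on \<open>M\<close> or
  \<open>S\<close>.\<close>

lemma local_cover:
  fixes N :: "nat set_system"
  assumes N: "(\<exists>k\<ge>2. N = uniform_matroid 2 k) \<or> N = uniform_matroid 3 6 \<or>
           N = P6 \<or> N = Q6 \<or> N = R6"
  obtains c :: nat where "\<And>(M :: 'a set_system) S. M \<in> excluding N \<Longrightarrow> S \<subseteq> ground M \<Longrightarrow>
      card S + 3 = matroid_rank M \<Longrightarrow>
      \<exists>\<F>. bounds_rank M \<F> \<and> \<F> \<subseteq> UNIV \<times> {0..matroid_rank M} \<and> card \<F> \<le> 1 + c * card (ground M) \<and>
        (\<forall>X. S \<subseteq> X \<and> X \<subseteq> ground M \<and> card X = matroid_rank M \<and> X \<notin> indeps M \<longrightarrow> covered \<F> X)"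
proof -
  have "\<exists>c. \<forall>(M :: 'a set_system) P. matroid M \<and> (\<forall>X\<in>indeps M. card X \<le> 3) \<and> simplification M P \<and>
     (\<forall>M'. is_minor M' M \<longrightarrow> \<not> isomorphic M' N) \<longrightarrow>
     card {L \<in> lines_on M P. 3 \<le> card L} \<le> c * card P"
  proof (cases "\<exists>k. N = uniform_matroid 2 k")
    case True
    then obtain k where k: "N = uniform_matroid 2 k" by blast
    show ?thesis
    proof (intro exI[of _ k] allI impI, elim conjE)
      fix M :: "'a set_system" and P
      assume "matroid M" "\<forall>X\<in>indeps M. card X \<le> 3" "simplification M P"
        "\<forall>M'. is_minor M' M \<longrightarrow> \<not> isomorphic M' N"
      then show "card {L \<in> lines_on M P. 3 \<le> card L} \<le> k * card P"
        unfolding k by (intro card_long_lines_excluding_uniform_two; blast)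
    qed
  next
    case False
    then have N': "N = uniform_matroid 3 6 \<or> N = P6 \<or> N = Q6 \<or> N = R6" using N by blast
    show ?thesis
    proof (intro exI[of _ 600] allI impI, elim conjE)
      fix M :: "'a set_system" and P
      assume "matroid M" "\<forall>X\<in>indeps M. card X \<le> 3" "simplification M P"
        "\<forall>M'. is_minor M' M \<longrightarrow> \<not> isomorphic M' N"
      then show "card {L \<in> lines_on M P. 3 \<le> card L} \<le> 600 * card P"
        by (intro card_long_lines_excluding_six[OF _ _ _ N']; blast)
    qed
  qed
  then obtain c where c: "\<And>(M :: 'a set_system) P. matroid M \<Longrightarrow> (\<And>X. X \<in> indeps M \<Longrightarrow> card X \<le> 3) \<Longrightarrow>
     simplification M P \<Longrightarrow> (\<And>M'. is_minor M' M \<Longrightarrow> \<not> isomorphic M' N) \<Longrightarrow>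
     card {L \<in> lines_on M P. 3 \<le> card L} \<le> c * card P"
    by metis
  show ?thesis
  \<comment> \<open>Here \<open>c\<close> counts long lines per point, the added 1 pays for the
    parallel classes, and the leading 1 of the bound for the loops.\<close>
  proof (rule that[of "1 + c"])
    fix M :: "'a set_system" and S
    assume "M \<in> excluding N" and SE: "S \<subseteq> ground M" and cS: "card S + 3 = matroid_rank M"
    then have M: "matroid M" and excl: "\<And>M'. is_minor M' M \<Longrightarrow> \<not> isomorphic M' N"
      by (auto simp: excluding_def)
    have finE: "finite (ground M)" by (rule matroid_finite_ground[OF M])
    have finS: "finite S" using SE finE finite_subset by blast
    show "\<exists>\<F>. bounds_rank M \<F> \<and> \<F> \<subseteq> UNIV \<times> {0..matroid_rank M} \<and>
        card \<F> \<le> 1 + (1 + c) * card (ground M) \<and>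
        (\<forall>X. S \<subseteq> X \<and> X \<subseteq> ground M \<and> card X = matroid_rank M \<and> X \<notin> indeps M \<longrightarrow> covered \<F> X)"
    proof (cases "S \<in> indeps M")
      case False
      have "rk M S \<noteq> card S" using rk_eq_card_iff[OF M finS] False by simp
      then have rS: "rk M S < card S" using rk_le_card[OF M finS] by simp
      \<comment> \<open>A dependent \<open>S\<close> certifies all its supersets with a single
        pair.\<close>
      have "covered {(S, rk M S)} X" if "S \<subseteq> X" for X
        using rS that by (simp add: covered_def Int_absorb1)
      then show ?thesis
        using SE rS cS by (intro exI[of _ "{(S, rk M S)}"]) (auto simp: bounds_rank_def)
    next
      case True
      let ?M = "contract M S"
      have M': "matroid ?M" by (rule matroid_contract[OF M])
      have gM': "ground ?M = ground M - S" by (simp add: contract_def)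
      have iM': "X \<in> indeps ?M \<longleftrightarrow> X \<subseteq> ground M - S \<and> X \<union> S \<in> indeps M" for X
        by (simp add: contract_indep[OF True])
      have rank3: "card X \<le> 3" if "X \<in> indeps ?M" for X
      proof -
        have X: "X \<subseteq> ground M - S" "X \<union> S \<in> indeps M" using that iM' by auto
        have "card (X \<union> S) = card X + card S"
          using X(1) finS finE by (intro card_Un_disjoint) (auto intro: finite_subset)
        then show ?thesis using card_le_matroid_rank[OF M X(2)] cS by simp
      qed
      obtain P where P: "simplification ?M P" by (rule simplification_exists[OF M'])
      have ll: "card {L \<in> lines_on ?M P. 3 \<le> card L} \<le> c * card P"
        using c[OF M' rank3 P] excl is_minor_contract[OF M True] by blast
      obtain \<F> where F: "bounds_rank ?M \<F>" "\<F> \<subseteq> UNIV \<times> {0..2}"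
          "card \<F> \<le> 1 + card (ground ?M) + card {L \<in> lines_on ?M P. 3 \<le> card L}"
          "\<And>X. X \<subseteq> ground ?M \<Longrightarrow> card X = 3 \<Longrightarrow> X \<notin> indeps ?M \<Longrightarrow> covered \<F> X"
        using cover_rank_three[OF M' P, of thesis] by blast
      have gle: "card (ground ?M) \<le> card (ground M)" unfolding gM' using finE by (intro card_mono) auto
      have "card P \<le> card (ground ?M)"
        using P matroid_finite_ground[OF M'] by (intro card_mono) (auto simp: simplification_def)
      then have "c * card P \<le> c * card (ground M)" using gle by (intro mult_le_mono2) linarith
      then have cF: "card \<F> \<le> 1 + (1 + c) * card (ground M)"
        using F(3) ll gle unfolding distrib_right mult_1 by linarith
      define \<G> where "\<G> = (\<lambda>(F, k). (F \<union> S, k + card S)) ` \<F>"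
      have finF: "finite \<F>"
      proof (rule finite_subset)
        show "\<F> \<subseteq> Pow (ground ?M) \<times> {0..2}" using F(1,2) by (fastforce simp: bounds_rank_def)
        show "finite (Pow (ground ?M) \<times> {0..2::nat})" using matroid_finite_ground[OF M'] by simp
      qed
      have "card \<G> \<le> card \<F>" unfolding \<G>_def using finF by (rule card_image_le)
      then have 1: "card \<G> \<le> 1 + (1 + c) * card (ground M)" using cF by simp
      have 2: "bounds_rank M \<G>"
        unfolding bounds_rank_def
      proof clarify
        fix F k assume "(F, k) \<in> \<G>"
        then obtain F' k' where F': "(F', k') \<in> \<F>" "F = F' \<union> S" "k = k' + card S"
          by (auto simp: \<G>_def)
        then have "F' \<subseteq> ground M - S" "rk ?M F' \<le> k'" using F(1) gM' by (auto simp: bounds_rank_def)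
        then show "F \<subseteq> ground M \<and> rk M F \<le> k"
          using rk_contract[OF M True, of F'] F' SE by auto
      qed
      have 3: "\<G> \<subseteq> UNIV \<times> {0..matroid_rank M}"
      proof
        fix z assume "z \<in> \<G>"
        then obtain F' k' where F': "(F', k') \<in> \<F>" "z = (F' \<union> S, k' + card S)"
          by (auto simp: \<G>_def)
        then have "k' \<le> 2" using F(2) by auto
        then show "z \<in> UNIV \<times> {0..matroid_rank M}" using F' cS by simp
      qed
      have 4: "covered \<G> X"
        if X: "S \<subseteq> X" "X \<subseteq> ground M" "card X = matroid_rank M" "X \<notin> indeps M" for X
      proof -
        have finX: "finite X" using X finE finite_subset by blast
        have "(X - S) \<union> S = X" using X by auto
        then have "X - S \<notin> indeps ?M" using iM' X by simp
        moreover have "card (X - S) = 3" using X cS finS by (simp add: card_Diff_subset)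
        moreover have "X - S \<subseteq> ground ?M" using X gM' by auto
        ultimately have "covered \<F> (X - S)" using F(4) by blast
        then show ?thesis unfolding \<G>_def using covered_lift_contract[OF _ X(1) finX F(1)] by blast
      qed
      show ?thesis using 1 2 3 4 by blast
    qed
  qed
qed

section \<open>Counting\<close>

text \<open>By double counting, some \<open>b\<close> is related to at least a fraction
  \<open>d / card B\<close> of the elements not yet handled. Each greedy step therefore multiplies
  their number by at most \<open>1 - d / card B\<close>, which is below
  \<open>exp (- d / card B)\<close>.\<close>

lemma greedy_cover:
  fixes d :: nat
  assumes fin: "finite A" "finite B" and B: "B \<noteq> {}"
    and deg: "\<And>a. a \<in> A \<Longrightarrow> d \<le> card {b \<in> B. R a b}"
  shows "\<exists>T \<subseteq> B. card T \<le> t \<and>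
    real (card {a \<in> A. \<not> (\<exists>b\<in>T. R a b)}) \<le> real (card A) * exp (- real t * real d / real (card B))"
proof (induction t)
  case 0
  show ?case by (intro exI[of _ "{}"]) auto
next
  case (Suc t)
  then obtain T where T: "T \<subseteq> B" "card T \<le> t" and
    le: "real (card {a \<in> A. \<not> (\<exists>b\<in>T. R a b)}) \<le> real (card A) * exp (- real t * real d / real (card B))"
    by blast
  define U where "U = {a \<in> A. \<not> (\<exists>b\<in>T. R a b)}"
  have finU: "finite U" using fin by (simp add: U_def)
  have cB: "card B > 0" using B fin by (simp add: card_gt_0_iff)
  have "\<exists>b\<in>B. real d * real (card U) / real (card B) \<le> real (card {a \<in> U. R a b})"
  proof (rule ccontr)
    assume "\<not> ?thesis"
    then have "(\<Sum>b\<in>B. real (card {a \<in> U. R a b})) < (\<Sum>b\<in>B. real d * real (card U) / real (card B))"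
      using fin B by (intro sum_strict_mono) auto
    also have "\<dots> = real d * real (card U)" using cB by simp
    also have "\<dots> = real (\<Sum>a\<in>U. d)" by simp
    also have "\<dots> \<le> real (\<Sum>a\<in>U. card {b \<in> B. R a b})"
      using deg unfolding of_nat_le_iff by (intro sum_mono) (auto simp: U_def)
    also have "(\<Sum>a\<in>U. card {b \<in> B. R a b}) = (\<Sum>b\<in>B. card {a \<in> U. R a b})"
      using finU fin by (intro sum_multicount_gen) auto
    finally show False by simp
  qed
  then obtain b where b: "b \<in> B" "real d * real (card U) / real (card B) \<le> real (card {a \<in> U. R a b})"
    by blast
  have eq: "{a \<in> A. \<not> (\<exists>b\<in>insert b T. R a b)} = U - {a \<in> U. R a b}" by (auto simp: U_def)
  have "real (card (U - {a \<in> U. R a b})) = real (card U) - real (card {a \<in> U. R a b})"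
    using finU by (simp add: card_Diff_subset card_mono of_nat_diff)
  also have "\<dots> \<le> real (card U) * (1 + - (real d / real (card B)))"
    using b by (simp add: algebra_simps)
  also have "\<dots> \<le> real (card U) * exp (- (real d / real (card B)))"
    by (intro mult_left_mono exp_ge_add_one_self) simp
  also have "\<dots> \<le> (real (card A) * exp (- real t * real d / real (card B))) * exp (- (real d / real (card B)))"
    using le by (intro mult_right_mono) (auto simp: U_def)
  also have "\<dots> = real (card A) * exp (- real (Suc t) * real d / real (card B))"
  proof -
    have "- real t * real d / real (card B) + - (real d / real (card B)) = - real (Suc t) * real d / real (card B)"
      using cB by (simp add: field_simps)
    then show ?thesis by (metis exp_add mult.assoc)
  qed
  finally have "real (card {a \<in> A. \<not> (\<exists>b\<in>insert b T. R a b)})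
      \<le> real (card A) * exp (- real (Suc t) * real d / real (card B))"
    by (simp only: eq)
  moreover have "card (insert b T) \<le> Suc t" 
    using T finite_subset[OF T(1) fin(2)] by (simp add: card_insert_if)
  ultimately show ?case using T(1) b(1) by (intro exI[of _ "insert b T"]) auto
qed

section \<open>Encoding a matroid by its rank and a flat cover\<close>

lemma rk_ground:
  assumes "matroid M"
  shows "rk M (ground M) = matroid_rank M"
proof -
  have "{X \<in> indeps M. X \<subseteq> ground M} = indeps M" using matroid_indep_ground[OF assms] by auto
  then show ?thesis by (simp add: rk_def matroid_rank_def)
qed

text \<open>Bounding the first components by the ground set and the second by the rank puts all
  covers over a given ground set in one finite universe, where they can be counted.\<close>

definition flat_cover :: "'a set_system \<Rightarrow> ('a set \<times> nat) set \<Rightarrow> bool" where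
  "flat_cover M \<F> \<longleftrightarrow> bounds_rank M \<F> \<and> \<F> \<subseteq> UNIV \<times> {0..matroid_rank M} \<and>
     (\<forall>X. X \<subseteq> ground M \<and> card X = matroid_rank M \<and> X \<notin> indeps M \<longrightarrow> covered \<F> X)"

text \<open>The uncovered sets of full rank size are exactly the bases: a basis meets
  \<open>G\<close> in at most \<open>rk M G\<close> elements, and the dependent sets of that size
  are covered. So ground set, rank and cover determine the matroid.\<close>

lemma flat_cover_indep_iff:
  assumes M: "matroid M" and F: "flat_cover M \<F>"
  shows "X \<in> indeps M \<longleftrightarrow> (\<exists>B. X \<subseteq> B \<and> B \<subseteq> ground M \<and> card B = matroid_rank M \<and> \<not> covered \<F> B)"
proof
  assume X: "X \<in> indeps M"
  obtain B where B: "basis_of M (ground M) B" "X \<subseteq> B"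
    using basis_of_extend[OF M X matroid_indep_ground[OF M X]] by blast
  have B': "B \<in> indeps M" "B \<subseteq> ground M" using B(1) by (auto simp: basis_of_def)
  have "\<not> covered \<F> B"
  proof
    assume "covered \<F> B"
    then obtain G k where G: "(G, k) \<in> \<F>" "k < card (B \<inter> G)" by (auto simp: covered_def)
    have "B \<inter> G \<in> indeps M" by (rule matroid_indep_subset[OF M B'(1)]) simp
    then have "card (B \<inter> G) \<le> rk M G" by (rule card_indep_le_rk[OF M]) simp
    moreover have "rk M G \<le> k" using F G(1) by (auto simp: flat_cover_def bounds_rank_def)
    ultimately show False using G(2) by simp
  qed
  then show "\<exists>B. X \<subseteq> B \<and> B \<subseteq> ground M \<and> card B = matroid_rank M \<and> \<not> covered \<F> B"
    using B B' rk_eq_card_basis[OF M B(1)] rk_ground[OF M] by (intro exI[of _ B]) simp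
next
  assume "\<exists>B. X \<subseteq> B \<and> B \<subseteq> ground M \<and> card B = matroid_rank M \<and> \<not> covered \<F> B"
  then obtain B where B: "X \<subseteq> B" "B \<subseteq> ground M" "card B = matroid_rank M" "\<not> covered \<F> B"
    by blast
  then have "B \<in> indeps M" using F by (auto simp: flat_cover_def)
  then show "X \<in> indeps M" using B(1) by (rule matroid_indep_subset[OF M])
qed

text \<open>Sending a matroid to its rank and a chosen small cover is injective; the factor
  \<open>n + 1\<close> counts the ranks.\<close>

lemma card_with_small_flat_cover:
  assumes sub: "\<C> \<subseteq> matroids_on n"
    and cov: "\<And>M. M \<in> \<C> \<Longrightarrow> \<exists>\<F>. flat_cover M \<F> \<and> card \<F> \<le> K"
  shows "card \<C> \<le> (n + 1) * card {Z. Z \<subseteq> Pow {1..n} \<times> {0..n} \<and> card Z \<le> K}"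
proof -
  let ?Z = "{Z. Z \<subseteq> Pow {1..n} \<times> {0..n} \<and> card Z \<le> K}"
  obtain \<phi> where \<phi>: "\<And>M. M \<in> \<C> \<Longrightarrow> flat_cover M (\<phi> M)" "\<And>M. M \<in> \<C> \<Longrightarrow> card (\<phi> M) \<le> K"
    using cov by metis
  have mat: "matroid M" "ground M = {1..n}" if "M \<in> \<C>" for M
    using sub that by (auto simp: matroids_on_def)
  have "inj_on (\<lambda>M. (matroid_rank M, \<phi> M)) \<C>"
  proof (rule inj_onI)
    fix M M' assume M: "M \<in> \<C>" "M' \<in> \<C>" "(matroid_rank M, \<phi> M) = (matroid_rank M', \<phi> M')"
    then have "indeps M = indeps M'"
      using flat_cover_indep_iff[OF mat(1) \<phi>(1), OF M(1,1)] flat_cover_indep_iff[OF mat(1) \<phi>(1), OF M(2,2)]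
        mat(2)[OF M(1)] mat(2)[OF M(2)] by (intro set_eqI) simp
    then show "M = M'" using mat(2) M by (simp add: prod_eq_iff)
  qed
  moreover have "(\<lambda>M. (matroid_rank M, \<phi> M)) ` \<C> \<subseteq> {0..n} \<times> ?Z"
  proof
    fix z assume "z \<in> (\<lambda>M. (matroid_rank M, \<phi> M)) ` \<C>"
    then obtain M where M: "M \<in> \<C>" "z = (matroid_rank M, \<phi> M)" by blast
    have r: "matroid_rank M \<le> n"
      using rk_ground[OF mat(1)[OF M(1)]] rk_le_card[OF mat(1)[OF M(1)], of "{1..n}"] mat(2)[OF M(1)] by simp
    have "\<phi> M \<subseteq> Pow {1..n} \<times> {0..n}"
    proof
      fix p assume p: "p \<in> \<phi> M"
      obtain G k where Gk: "p = (G, k)" by (cases p)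
      have "G \<subseteq> ground M" using \<phi>(1)[OF M(1)] p Gk by (auto simp: flat_cover_def bounds_rank_def)
      moreover have "k \<le> matroid_rank M" using \<phi>(1)[OF M(1)] p Gk by (auto simp: flat_cover_def)
      ultimately show "p \<in> Pow {1..n} \<times> {0..n}" using r mat(2)[OF M(1)] Gk by simp
    qed
    then show "z \<in> {0..n} \<times> ?Z" using M r \<phi>(2)[OF M(1)] by simp
  qed
  moreover have "finite ?Z" by (rule finite_subset[of _ "Pow (Pow {1..n} \<times> {0..n})"]) auto
  ultimately have "card \<C> \<le> card ({0..n} \<times> ?Z)" by (intro card_inj_on_le) auto
  then show ?thesis by (simp add: card_cartesian_product)
qed

text \<open>A subset of size \<open>i \<le> K\<close> gets the weight
  \<open>x ^ i * (1 / x) ^ K\<close>, which is at least 1. The binomial theorem sums these weights,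
  and \<open>1 + x \<le> exp x\<close>. The parameter \<open>x\<close> is left to be tuned.\<close>

lemma card_small_subsets_le:
  fixes x :: real
  assumes fin: "finite A" and x: "0 < x" "x \<le> 1"
  shows "real (card {Z. Z \<subseteq> A \<and> card Z \<le> K}) \<le> exp (x * real (card A)) * (1 / x) ^ K"
proof -
  let ?N = "card A"
  \<comment> \<open>The minimum is taken because \<open>K\<close> may exceed \<open>card A\<close>;
    the sum is later enlarged to all sizes.\<close>
  have "{Z. Z \<subseteq> A \<and> card Z \<le> K} = (\<Union>i\<in>{..min K ?N}. {Z. Z \<subseteq> A \<and> card Z = i})"
    using card_mono[OF fin] by auto
  then have "card {Z. Z \<subseteq> A \<and> card Z \<le> K} \<le> (\<Sum>i\<le>min K ?N. card {Z. Z \<subseteq> A \<and> card Z = i})"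
    by (simp add: card_UN_le)
  also have "\<dots> = (\<Sum>i\<le>min K ?N. ?N choose i)" using n_subsets[OF fin] by simp
  finally have "real (card {Z. Z \<subseteq> A \<and> card Z \<le> K}) \<le> (\<Sum>i\<le>min K ?N. real (?N choose i))"
    by (metis of_nat_mono of_nat_sum)
  also have "\<dots> \<le> (\<Sum>i\<le>min K ?N. real (?N choose i) * (x ^ i * (1 / x) ^ K))"
  proof (rule sum_mono)
    fix i assume "i \<in> {..min K ?N}"
    then have "x ^ K \<le> x ^ i" using x by (intro power_decreasing) auto
    then have "1 \<le> x ^ i * (1 / x) ^ K" using x by (simp add: power_one_over field_simps)
    then show "real (?N choose i) \<le> real (?N choose i) * (x ^ i * (1 / x) ^ K)"
      using mult_left_mono[of 1 _ "real (?N choose i)"] by simp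
  qed
  also have "\<dots> \<le> (\<Sum>i\<le>?N. real (?N choose i) * (x ^ i * (1 / x) ^ K))"
    using x by (intro sum_mono2) auto
  also have "\<dots> = (x + 1) ^ ?N * (1 / x) ^ K"
    by (simp add: binomial_ring sum_distrib_right mult.assoc)
  also have "\<dots> \<le> exp x ^ ?N * (1 / x) ^ K"
    using x exp_ge_add_one_self[of x] by (intro mult_right_mono power_mono) (auto simp: add.commute)
  also have "exp x ^ ?N = exp (x * real ?N)" using exp_of_nat_mult[of ?N x] by (simp add: mult.commute)
  finally show ?thesis .
qed

text \<open>The covers attached to members of \<open>T\<close> handle all sets containing such a
  member. Every remaining \<open>X\<close> gets its own pair \<open>(X, rk M X)\<close>, which
  covers \<open>X\<close> exactly when it is dependent.\<close>

lemma flat_cover_of_transversal: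
  assumes M: "matroid M" and T: "finite T"
    and loc: "\<And>S. S \<in> T \<Longrightarrow> \<exists>\<F>. bounds_rank M \<F> \<and> \<F> \<subseteq> UNIV \<times> {0..matroid_rank M} \<and> card \<F> \<le> k \<and>
        (\<forall>X. S \<subseteq> X \<and> X \<subseteq> ground M \<and> card X = matroid_rank M \<and> X \<notin> indeps M \<longrightarrow> covered \<F> X)"
  shows "\<exists>\<F>. flat_cover M \<F> \<and> card \<F> \<le>
    card T * k + card {X. X \<subseteq> ground M \<and> card X = matroid_rank M \<and> \<not> (\<exists>S\<in>T. S \<subseteq> X)}"
proof -
  let ?r = "matroid_rank M"
  let ?A = "{X. X \<subseteq> ground M \<and> card X = ?r \<and> \<not> (\<exists>S\<in>T. S \<subseteq> X)}"
  define good where "good S \<F> \<longleftrightarrow> bounds_rank M \<F> \<and> \<F> \<subseteq> UNIV \<times> {0..?r} \<and> card \<F> \<le> k \<and>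
      (\<forall>X. S \<subseteq> X \<and> X \<subseteq> ground M \<and> card X = ?r \<and> X \<notin> indeps M \<longrightarrow> covered \<F> X)" for S \<F>
  have "\<exists>\<F>. good S \<F>" if "S \<in> T" for S unfolding good_def by (rule loc[OF that])
  then obtain \<phi> where good: "\<And>S. S \<in> T \<Longrightarrow> good S (\<phi> S)" by metis
  have \<phi>: "bounds_rank M (\<phi> S)" "\<phi> S \<subseteq> UNIV \<times> {0..?r}" "card (\<phi> S) \<le> k" if "S \<in> T" for S
    using good[OF that] by (simp_all add: good_def)
  have \<phi>cov: "covered (\<phi> S) X"
    if "S \<in> T" "S \<subseteq> X" "X \<subseteq> ground M" "card X = ?r" "X \<notin> indeps M" for S X
    using good[OF that(1)] that unfolding good_def by blast
  define \<F> where "\<F> = (\<Union>S\<in>T. \<phi> S) \<union> (\<lambda>X. (X, rk M X)) ` ?A"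
  have finE: "finite (ground M)" by (rule matroid_finite_ground[OF M])
  have finA: "finite ?A" using finE by simp
  have rkle: "rk M X \<le> ?r" if "X \<subseteq> ground M" for X
    using rk_mono[OF M that] rk_ground[OF M] by simp
  have "bounds_rank M \<F>" using \<phi>(1) by (fastforce simp: bounds_rank_def \<F>_def)
  moreover have "\<F> \<subseteq> UNIV \<times> {0..?r}" using \<phi>(2) rkle by (fastforce simp: \<F>_def)
  moreover have "covered \<F> X" if X: "X \<subseteq> ground M" "card X = ?r" "X \<notin> indeps M" for X
  proof (cases "\<exists>S\<in>T. S \<subseteq> X")
    case True
    then obtain S where "S \<in> T" "S \<subseteq> X" by blast
    then have "S \<in> T" "covered (\<phi> S) X" using \<phi>cov X by auto
    then show ?thesis unfolding covered_def \<F>_def by blast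
  next
    case False
    have finX: "finite X" using X(1) finE finite_subset by blast
    have "rk M X \<noteq> card X" using rk_eq_card_iff[OF M finX] X(3) by simp
    then have "rk M X < card (X \<inter> X)" using rk_le_card[OF M finX] by simp
    moreover have "(X, rk M X) \<in> \<F>" using X False by (auto simp: \<F>_def)
    ultimately show ?thesis unfolding covered_def by blast
  qed
  ultimately have "flat_cover M \<F>" unfolding flat_cover_def by blast
  moreover have "card \<F> \<le> card T * k + card ?A"
  proof -
    have "card (\<Union>S\<in>T. \<phi> S) \<le> (\<Sum>S\<in>T. card (\<phi> S))" using T by (rule card_UN_le)
    also have "\<dots> \<le> (\<Sum>S\<in>T. k)" using \<phi>(3) by (intro sum_mono) auto
    finally have "card (\<Union>S\<in>T. \<phi> S) \<le> card T * k" by simp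
    moreover have "card ((\<lambda>X. (X, rk M X)) ` ?A) \<le> card ?A" using finA by (rule card_image_le)
    ultimately show ?thesis unfolding \<F>_def by (meson add_mono card_Un_le order_trans)
  qed
  ultimately show ?thesis by blast
qed

section \<open>Estimates for binomial coefficients\<close>

text \<open>\<open>rec\<close> gives the ratio of consecutive central coefficients; with the weight
  \<open>sqrt (2 * m + 1)\<close> the induction step reduces to (2m + 1)(2m + 3) <= (2m +
  2)^2.\<close>

lemma central_binomial_upper: "real ((2 * m) choose m) * sqrt (real (2 * m + 1)) \<le> 4 ^ m"
proof (induction m)
  case 0
  then show ?case by simp
next
  case (Suc m)
  have rec: "real ((2 * Suc m) choose Suc m) = real ((2 * m) choose m) * (2 * (2 * real m + 1) / (real m + 1))"
  proof -
    have "Suc m * ((2 * Suc m) choose Suc m) = (2 * Suc m) * ((2 * m + 1) choose m)"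
      using Suc_times_binomial_eq[of "2 * m + 1" m] by (simp add: mult.commute)
    moreover have "Suc m * ((2 * m + 1) choose m) = (2 * m + 1) * ((2 * m) choose m)"
    proof -
      have "(2 * m + 1) choose m = (2 * m + 1) choose Suc m"
        using binomial_symmetric[of m "2 * m + 1"] by simp
      then show ?thesis using Suc_times_binomial_eq[of "2 * m" m] by (simp add: mult.commute)
    qed
    ultimately have "real (Suc m) * (real (Suc m) * real ((2 * Suc m) choose Suc m)) =
        real (2 * Suc m) * (real (2 * m + 1) * real ((2 * m) choose m))"
      by (metis (no_types, lifting) mult.left_commute of_nat_mult)
    then have "(real m + 1) * ((real m + 1) * real ((2 * Suc m) choose Suc m)) =
        (real m + 1) * (2 * (2 * real m + 1) * real ((2 * m) choose m))"
      by (simp add: algebra_simps)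
    then have "(real m + 1) * real ((2 * Suc m) choose Suc m) = 2 * (2 * real m + 1) * real ((2 * m) choose m)"
      by simp
    then show ?thesis by (simp add: field_simps)
  qed
  have "(2 * real m + 1) * sqrt (2 * real m + 3) \<le> 2 * (real m + 1) * sqrt (2 * real m + 1)"
  proof (rule power2_le_imp_le)
    show "((2 * real m + 1) * sqrt (2 * real m + 3))\<^sup>2 \<le> (2 * (real m + 1) * sqrt (2 * real m + 1))\<^sup>2"
      by (simp add: power_mult_distrib) (simp add: power2_eq_square algebra_simps)
  qed simp
  then have *: "2 * (2 * real m + 1) / (real m + 1) * sqrt (2 * real m + 3) \<le> 4 * sqrt (2 * real m + 1)"
    by (simp add: field_simps)
  have "real ((2 * Suc m) choose Suc m) * sqrt (real (2 * Suc m + 1)) =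
      real ((2 * m) choose m) * (2 * (2 * real m + 1) / (real m + 1) * sqrt (2 * real m + 3))"
    unfolding rec by (simp add: algebra_simps)
  also have "\<dots> \<le> real ((2 * m) choose m) * (4 * sqrt (2 * real m + 1))"
    using * by (rule mult_left_mono) simp
  also have "\<dots> \<le> 4 ^ Suc m" using Suc by (simp add: algebra_simps)
  finally show ?case .
qed

lemma binomial_le_two_power_div_sqrt:
  assumes "0 < n"
  shows "real (n choose k) \<le> 2 ^ n / sqrt (real n)"
proof (cases "even n")
  case True
  then obtain m where m: "n = 2 * m" by (elim evenE)
  have "real (n choose k) * sqrt (real n) \<le> real ((2 * m) choose m) * sqrt (real (2 * m + 1))"
    using binomial_maximum'[of m k] unfolding m by (intro mult_mono) auto
  also have "\<dots> \<le> 4 ^ m" by (rule central_binomial_upper)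
  also have "\<dots> = 2 ^ n" by (simp add: m power_mult)
  finally show ?thesis using assms by (simp add: field_simps)
next
  case False
  then obtain m where m: "n = 2 * m + 1" by (elim oddE)
  \<comment> \<open>For odd \<open>n\<close> the two equal middle coefficients add up to the next
    central one.\<close>
  have "2 * (n choose k) \<le> (2 * Suc m) choose Suc m"
  proof -
    have "n choose k \<le> n choose (n div 2)" by (rule binomial_maximum)
    also have "n div 2 = m" by (simp add: m)
    finally have "n choose k \<le> n choose m" .
    moreover have "n choose m = n choose Suc m" using binomial_symmetric[of m n] by (simp add: m)
    moreover have "(2 * Suc m) choose Suc m = (n choose m) + (n choose Suc m)" by (simp add: m)
    ultimately show ?thesis by linarith
  qed
  then have "2 * real (n choose k) \<le> real ((2 * Suc m) choose Suc m)"
    by (metis of_nat_mono of_nat_mult of_nat_numeral)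
  then have "2 * real (n choose k) * sqrt (real n) \<le> real ((2 * Suc m) choose Suc m) * sqrt (real (2 * Suc m + 1))"
    by (intro mult_mono) (auto simp: m)
  also have "\<dots> \<le> 4 ^ Suc m" by (rule central_binomial_upper)
  also have "\<dots> = 2 * 2 ^ n" by (simp add: m power_mult)
  finally show ?thesis using assms by (simp add: field_simps)
qed

text \<open>Weighting the binomial sum by powers of 1/2 bounds the coefficient by (3/2)^n 2^r, and
  2^r <= (6/5)^n because 2 < (6/5)^4 and 4r <= n. The resulting base 9/5 is below 2.\<close>

lemma binomial_small_le:
  assumes "4 * r \<le> n"
  shows "real (n choose r) \<le> (9 / 5) ^ n"
proof -
  have "real (n choose r) * (1 / 2) ^ r \<le> (\<Sum>i\<le>n. real (n choose i) * (1 / 2) ^ i)"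
    using assms by (intro member_le_sum) auto
  also have "\<dots> = (1 / 2 + 1) ^ n" using binomial_ring[of "1 / 2 :: real" 1 n] by simp
  finally have "real (n choose r) \<le> (3 / 2) ^ n * 2 ^ r" by (simp add: power_one_over field_simps)
  also have "(2::real) ^ r \<le> ((6 / 5) ^ 4) ^ r" by (intro power_mono) (auto simp: power_divide)
  also have "((6 / 5) ^ 4) ^ r = (6 / 5 :: real) ^ (4 * r)" by (rule power_mult[symmetric])
  also have "\<dots> \<le> (6 / 5) ^ n" using assms by (intro power_increasing) auto
  also have "(3 / 2) ^ n * (6 / 5 :: real) ^ n = (9 / 5) ^ n" by (simp flip: power_mult_distrib)
  finally show ?thesis by simp
qed

section \<open>Small flat covers for the whole class\<close>

text \<open>\<open>greedy_cover\<close> chooses sets of size \<open>r - 3\<close> so that most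
  \<open>r\<close>-sets contain one of them. The number \<open>t\<close> of greedy steps stays free,
  while \<open>c\<close> depends on \<open>N\<close> only.\<close>

lemma excluding_flat_cover:
  fixes N :: "nat set_system"
  assumes N: "(\<exists>k\<ge>2. N = uniform_matroid 2 k) \<or> N = uniform_matroid 3 6 \<or>
           N = P6 \<or> N = Q6 \<or> N = R6"
  obtains c :: nat where
    "\<And>n M t. M \<in> excluding N \<inter> matroids_on n \<Longrightarrow> 3 \<le> matroid_rank M \<Longrightarrow>
      \<exists>\<F>. flat_cover M \<F> \<and> real (card \<F>) \<le> real t * (1 + real c * real n) +
        real (n choose matroid_rank M) *
        exp (- real t * real (matroid_rank M choose 3) / real (n choose (matroid_rank M - 3)))"
proof -
  obtain c :: nat where c: "\<And>(M :: nat set_system) S. M \<in> excluding N \<Longrightarrow> S \<subseteq> ground M \<Longrightarrow>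
      card S + 3 = matroid_rank M \<Longrightarrow>
      \<exists>\<F>. bounds_rank M \<F> \<and> \<F> \<subseteq> UNIV \<times> {0..matroid_rank M} \<and> card \<F> \<le> 1 + c * card (ground M) \<and>
        (\<forall>X. S \<subseteq> X \<and> X \<subseteq> ground M \<and> card X = matroid_rank M \<and> X \<notin> indeps M \<longrightarrow> covered \<F> X)"
    by (rule local_cover[OF N, where 'a = nat]) blast
  show ?thesis
  proof (rule that[of c])
    fix n t and M :: "nat set_system"
    assume "M \<in> excluding N \<inter> matroids_on n" and r3: "3 \<le> matroid_rank M"
    then have ex: "M \<in> excluding N" and M: "matroid M" and g: "ground M = {1..n}"
      by (auto simp: matroids_on_def)
    define r where "r = matroid_rank M"
    have r3: "3 \<le> r" using r3 by (simp add: r_def)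
    have rn: "r \<le> n" using rk_ground[OF M] rk_le_card[OF M, of "{1..n}"] g by (simp add: r_def)
    define A where "A = {X. X \<subseteq> {1..n} \<and> card X = r}"
    define B where "B = {S. S \<subseteq> {1..n} \<and> card S = r - 3}"
    have cA: "card A = n choose r" and cB: "card B = n choose (r - 3)"
      unfolding A_def B_def by (simp_all add: n_subsets)
    have fA: "finite A" and fB: "finite B" unfolding A_def B_def by simp_all
    have "card B > 0" unfolding cB using rn by (simp add: zero_less_binomial_iff)
    then have neB: "B \<noteq> {}" by auto
    \<comment> \<open>Each \<open>r\<close>-set contains \<open>r choose (r - 3)\<close> candidates,
      which is the degree fed into the greedy choice.\<close>
    have deg: "r choose 3 \<le> card {S \<in> B. S \<subseteq> X}" if "X \<in> A" for X
    proof -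
      have X: "X \<subseteq> {1..n}" "card X = r" "finite X" using that finite_subset by (auto simp: A_def)
      have "{S \<in> B. S \<subseteq> X} = {S. S \<subseteq> X \<and> card S = r - 3}" using X(1) by (auto simp: B_def)
      then have "card {S \<in> B. S \<subseteq> X} = r choose (r - 3)" using n_subsets[OF X(3)] X(2) by simp
      then show ?thesis using binomial_symmetric[OF r3] by simp
    qed
    obtain T where T: "T \<subseteq> B" "card T \<le> t"
        "real (card {X \<in> A. \<not> (\<exists>S\<in>T. S \<subseteq> X)}) \<le> real (card A) * exp (- real t * real (r choose 3) / real (card B))"
      using greedy_cover[OF fA fB neB, of "r choose 3" "\<lambda>X S. S \<subseteq> X" t] deg by blast
    have fT: "finite T" using T(1) fB finite_subset by blast
    have loc: "\<exists>\<F>. bounds_rank M \<F> \<and> \<F> \<subseteq> UNIV \<times> {0..matroid_rank M} \<and> card \<F> \<le> 1 + c * n \<and>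
        (\<forall>X. S \<subseteq> X \<and> X \<subseteq> ground M \<and> card X = matroid_rank M \<and> X \<notin> indeps M \<longrightarrow> covered \<F> X)"
      if "S \<in> T" for S
    proof -
      have S: "S \<subseteq> {1..n}" "card S = r - 3" using that T(1) by (auto simp: B_def)
      then show ?thesis using c[OF ex, of S] g r3 by (simp add: r_def)
    qed
    obtain \<F> where F: "flat_cover M \<F>"
        "card \<F> \<le> card T * (1 + c * n) + card {X. X \<subseteq> ground M \<and> card X = matroid_rank M \<and> \<not> (\<exists>S\<in>T. S \<subseteq> X)}"
      using flat_cover_of_transversal[OF M fT loc] by blast
    have "{X. X \<subseteq> ground M \<and> card X = matroid_rank M \<and> \<not> (\<exists>S\<in>T. S \<subseteq> X)} = {X \<in> A. \<not> (\<exists>S\<in>T. S \<subseteq> X)}"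
      by (auto simp: A_def g r_def)
    then have "card \<F> \<le> card T * (1 + c * n) + card {X \<in> A. \<not> (\<exists>S\<in>T. S \<subseteq> X)}" using F(2) by simp
    also have "\<dots> \<le> t * (1 + c * n) + card {X \<in> A. \<not> (\<exists>S\<in>T. S \<subseteq> X)}"
      using T(2) by (intro add_right_mono mult_right_mono) auto
    finally have "real (card \<F>) \<le> real (t * (1 + c * n) + card {X \<in> A. \<not> (\<exists>S\<in>T. S \<subseteq> X)})"
      by (rule of_nat_mono)
    also have "\<dots> = real t * (1 + real c * real n) + real (card {X \<in> A. \<not> (\<exists>S\<in>T. S \<subseteq> X)})"
      by (simp add: distrib_left)
    also have "\<dots> \<le> real t * (1 + real c * real n) + real (n choose r) * exp (- real t * real (r choose 3) / real (n choose (r - 3)))"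
      using T(3) unfolding cA cB by simp
    finally show "\<exists>\<F>. flat_cover M \<F> \<and> real (card \<F>) \<le> real t * (1 + real c * real n) +
        real (n choose matroid_rank M) *
        exp (- real t * real (matroid_rank M choose 3) / real (n choose (matroid_rank M - 3)))"
      using F(1) unfolding r_def by blast
  qed
qed

text \<open>With an empty transversal every set of full rank size is certified separately.\<close>

lemma flat_cover_trivial:
  assumes M: "M \<in> matroids_on n"
  shows "\<exists>\<F>. flat_cover M \<F> \<and> card \<F> \<le> n choose matroid_rank M"
proof -
  have "matroid M" "ground M = {1..n}" using M by (auto simp: matroids_on_def)
  then show ?thesis
    using flat_cover_of_transversal[of M "{}" 0] n_subsets[of "{1..n}" "matroid_rank M"] by simp
qed

text \<open>For \<open>4 \<le> r\<close> both \<open>r - 1\<close> and \<open>r - 2\<close> are at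
  least \<open>r / 2\<close>; the constant is 24 = 6 * 4.\<close>

lemma choose_three_ge:
  assumes "4 \<le> r"
  shows "real r ^ 3 / 24 \<le> real (r choose 3)"
proof -
  have "real (r choose 3) = real r * (real r - 1) * (real r - 2) / 6"
  proof -
    have "real (r choose 3) = (real r gchoose 3)" by (rule binomial_gbinomial)
    also have "\<dots> = real r * (real r - 1) * (real r - 2) / 6"
      by (simp add: gbinomial_prod_rev numeral_3_eq_3 fact_numeral)
    finally show ?thesis .
  qed
  moreover have "real r ^ 3 / 4 \<le> real r * (real r - 1) * (real r - 2)"
  proof -
    have "real r * (real r / 2) * (real r / 2) \<le> real r * (real r - 1) * (real r - 2)"
      using assms by (intro mult_mono) auto
    then show ?thesis by (simp add: power3_eq_cube)
  qed
  ultimately show ?thesis by simp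
qed

text \<open>The constant \<open>4608 = 3 \<cdot> 1536\<close> makes the greedy choice leave a proportion of at most \<open>1 / n\<^sup>3\<close>.\<close>

lemma greedy_bound:
  fixes c :: real
  assumes r: "n \<le> 4 * r" "r \<le> n" and n: "16 \<le> n" and c: "0 \<le> c"
    and t: "t = nat \<lceil>4608 * 2 ^ n * ln (real n) / real n powr (7/2)\<rceil>"
  shows "real t * (1 + c * real n) +
      real (n choose r) * exp (- real t * real (r choose 3) / real (n choose (r - 3)))
    \<le> (4608 * 2 ^ n * ln (real n) / real n powr (7/2) + 1) * (1 + c * real n) + 2 ^ n / real n powr (7/2)"
proof -
  let ?s = "4608 * 2 ^ n * ln (real n) / real n powr (7/2)"
  let ?d = "real (r choose 3)" and ?b = "real (n choose (r - 3))"
  have n0: "0 < real n" using n by simp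
  have ln0: "0 \<le> ln (real n)" using n by simp
  have s0: "0 \<le> ?s" using ln0 by simp
  have ts: "?s \<le> real t" "real t \<le> ?s + 1" using s0 unfolding t by linarith+
  have pow: "real n powr (7/2) = real n ^ 3 * sqrt (real n)"
  proof -
    have "real n powr (7/2) = real n powr (3 + 1/2)" by simp
    also have "\<dots> = real n powr 3 * real n powr (1/2)" by (rule powr_add)
    finally show ?thesis using n0 by (simp add: powr_half_sqrt flip: powr_numeral)
  qed
  \<comment> \<open>The constant is 1536 = 24 * 64, where 64 comes from
    \<open>n \<le> 4 * r\<close>; moreover \<open>16 \<le> n\<close> ensures
    \<open>4 \<le> r\<close>.\<close>
  have d: "real n ^ 3 / 1536 \<le> ?d"
  proof -
    have "(real n / 4) ^ 3 \<le> real r ^ 3" using r by (intro power_mono) auto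
    then have "real n ^ 3 / 64 \<le> real r ^ 3" by (simp add: power_divide)
    then show ?thesis using choose_three_ge[of r] r n by simp
  qed
  have b: "?b \<le> 2 ^ n / sqrt (real n)" "0 < ?b"
    using binomial_le_two_power_div_sqrt[of n "r - 3"] r n by (auto simp: zero_less_binomial_iff)
  have "3 * ln (real n) * ?b \<le> 3 * ln (real n) * (2 ^ n / sqrt (real n))"
    using b ln0 by (intro mult_left_mono) auto
  also have "\<dots> = ?s * (real n ^ 3 / 1536)" unfolding pow using n0 by (simp add: field_simps)
  also have "\<dots> \<le> real t * ?d" using ts(1) d s0 by (intro mult_mono) auto
  finally have "3 * ln (real n) \<le> real t * ?d / ?b" using b(2) by (simp add: field_simps)
  then have "exp (- real t * ?d / ?b) \<le> exp (- (3 * ln (real n)))" by simp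
  also have "\<dots> = 1 / real n ^ 3"
    using n0 by (simp add: exp_minus field_simps exp_of_nat_mult[of 3 "ln (real n)", simplified])
  \<comment> \<open>A proportion 1/n^3 of at most 2^n / sqrt n sets produces the exponent
    7/2.\<close>
  finally have "real (n choose r) * exp (- real t * ?d / ?b) \<le> (2 ^ n / sqrt (real n)) * (1 / real n ^ 3)"
    using binomial_le_two_power_div_sqrt[of n r] n by (intro mult_mono) auto
  also have "\<dots> = 2 ^ n / real n powr (7/2)" unfolding pow by simp
  finally have 1: "real (n choose r) * exp (- real t * ?d / ?b) \<le> 2 ^ n / real n powr (7/2)" .
  have "real t * (1 + c * real n) \<le> (?s + 1) * (1 + c * real n)"
    using ts(2) c by (intro mult_right_mono) auto
  then show ?thesis using 1 by linarith
qed

text \<open>The argument splits at rank n/4: from there on the greedy choice is used, below it the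
  trivial cover, whose size is at most (9/5)^n and so exponentially smaller than 2^n.\<close>

lemma small_flat_covers:
  fixes N :: "nat set_system"
  assumes N: "(\<exists>k\<ge>2. N = uniform_matroid 2 k) \<or> N = uniform_matroid 3 6 \<or>
           N = P6 \<or> N = Q6 \<or> N = R6"
  obtains a :: real where "0 < a" "\<forall>\<^sub>F n in sequentially. \<forall>M \<in> excluding N \<inter> matroids_on n.
      \<exists>\<F>. flat_cover M \<F> \<and> real (card \<F>) \<le> a * 2 ^ n * ln (real n) / real n powr (5/2)"
proof -
  obtain c :: nat where c: "\<And>n M t. M \<in> excluding N \<inter> matroids_on n \<Longrightarrow> 3 \<le> matroid_rank M \<Longrightarrow>
      \<exists>\<F>. flat_cover M \<F> \<and> real (card \<F>) \<le> real t * (1 + real c * real n) +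
        real (n choose matroid_rank M) *
        exp (- real t * real (matroid_rank M choose 3) / real (n choose (matroid_rank M - 3)))"
    by (rule excluding_flat_cover[OF N]) blast
  define C where "C = real c"
  have C0: "0 \<le> C" by (simp add: C_def)
  \<comment> \<open>The part \<open>4608 * C\<close> is the number of greedy sets times the linear
    size of their local covers; the surplus absorbs all lower-order terms for large
    \<open>n\<close>.\<close>
  define a where "a = 4608 * (C + 1) + 1"
  have a0: "0 < a" using C0 by (simp add: a_def)
  have "\<forall>\<^sub>F n in sequentially. (9 / 5) ^ n \<le> 1 * 2 ^ n * ln (real n) / real n powr (5/2)"
    by real_asymp
  then have ev1: "\<forall>\<^sub>F n in sequentially. (9 / 5) ^ n \<le> a * 2 ^ n * ln (real n) / real n powr (5/2)"
    using eventually_ge_at_top[of 1]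
  proof eventually_elim
    case (elim n)
    have "1 * (2 ^ n * ln (real n) / real n powr (5/2)) \<le> a * (2 ^ n * ln (real n) / real n powr (5/2))"
      using elim C0 by (intro mult_right_mono) (auto simp: a_def)
    then show ?case using elim by simp
  qed
  have ev2: "\<forall>\<^sub>F n in sequentially. (4608 * 2 ^ n * ln (real n) / real n powr (7/2) + 1) * (1 + C * real n)
      + 2 ^ n / real n powr (7/2) \<le> (4608 * (C + 1) + 1) * 2 ^ n * ln (real n) / real n powr (5/2)"
    using C0 by real_asymp
  have "\<forall>\<^sub>F n in sequentially. \<forall>M \<in> excluding N \<inter> matroids_on n.
      \<exists>\<F>. flat_cover M \<F> \<and> real (card \<F>) \<le> a * 2 ^ n * ln (real n) / real n powr (5/2)"
    using ev1 ev2 eventually_ge_at_top[of 16]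
  proof eventually_elim
    case (elim n)
    show ?case
    proof
      fix M assume M: "M \<in> excluding N \<inter> matroids_on n"
      let ?r = "matroid_rank M"
      have mat: "matroid M" "ground M = {1..n}" using M by (auto simp: matroids_on_def)
      have rn: "?r \<le> n" using rk_ground[OF mat(1)] rk_le_card[OF mat(1), of "{1..n}"] mat(2) by simp
      show "\<exists>\<F>. flat_cover M \<F> \<and> real (card \<F>) \<le> a * 2 ^ n * ln (real n) / real n powr (5/2)"
      proof (cases "n \<le> 4 * ?r")
        case True
        define t where "t = nat \<lceil>4608 * 2 ^ n * ln (real n) / real n powr (7/2)\<rceil>"
        obtain \<F> where F: "flat_cover M \<F>" "real (card \<F>) \<le> real t * (1 + C * real n) +
            real (n choose ?r) * exp (- real t * real (?r choose 3) / real (n choose (?r - 3)))"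
          using c[OF M, of t] True elim(3) unfolding C_def by fastforce
        show ?thesis
          using F greedy_bound[OF True rn elim(3) C0 t_def] elim(2) unfolding a_def
          by (intro exI[of _ \<F>]) linarith
      next
        case False
        obtain \<F> where F: "flat_cover M \<F>" "card \<F> \<le> n choose ?r"
          using flat_cover_trivial[of M n] M by blast
        have "real (card \<F>) \<le> real (n choose ?r)" using F(2) by simp
        also have "\<dots> \<le> (9 / 5) ^ n" using False by (intro binomial_small_le) simp
        finally show ?thesis using F(1) elim(1) by (intro exI[of _ \<F>]) linarith
      qed
    qed
  qed
  then show ?thesis using a0 that by blast
qed

text \<open>Covers with at most \<open>K\<close> members are counted inside a universe of (n + 1)
  2^n pairs. As \<open>K\<close> is a polynomial fraction of that universe, a member costs about ln
  n rather than n. This is one logarithmic factor; the other comes from the number of greedy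
  sets.\<close>

theorem theorem4p1:
  fixes N :: "nat set_system"
  assumes "(\<exists>k\<ge>2. N = uniform_matroid 2 k) \<or> N = uniform_matroid 3 6 \<or>
           N = P6 \<or> N = Q6 \<or> N = R6"
  shows "(\<lambda>n. log 2 (real (card (excluding N \<inter> matroids_on n))))
           \<in> O(\<lambda>n. 2 ^ n / real n powr (5/2) * (log 2 (real n))\<^sup>2)"
proof -
  obtain a :: real where a: "0 < a" and cov: "\<forall>\<^sub>F n in sequentially. \<forall>M \<in> excluding N \<inter> matroids_on n.
      \<exists>\<F>. flat_cover M \<F> \<and> real (card \<F>) \<le> a * 2 ^ n * ln (real n) / real n powr (5/2)"
    by (rule small_flat_covers[OF assms])
  \<comment> \<open>The three terms stand for the choice of the rank, for
    \<open>exp (x * card A)\<close> with x = 1/n^4, which contributes order 2^n / n^3, and for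
    \<open>(1 / x) ^ K\<close>, which dominates.\<close>
  define h where "h n = (ln (real n + 1) + (real n + 1) * 2 ^ n / real n ^ 4 +
      4 * ln (real n) * (a * 2 ^ n * ln (real n) / real n powr (5/2))) / ln 2" for n :: nat
  have "\<forall>\<^sub>F n in sequentially. norm (log 2 (real (card (excluding N \<inter> matroids_on n)))) \<le> 1 * norm (h n)"
    using cov eventually_ge_at_top[of 1]
  proof eventually_elim
    case (elim n)
    define \<C> where "\<C> = excluding N \<inter> matroids_on n"
    define y where "y = a * 2 ^ n * ln (real n) / real n powr (5/2)"
    \<comment> \<open>Cardinalities are integers, so rounding the real bound \<open>y\<close> down
      loses nothing.\<close>
    define K where "K = nat \<lfloor>y\<rfloor>"
    have n1: "1 \<le> real n" using elim(2) by simp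
    have y0: "0 \<le> y" using a n1 by (simp add: y_def)
    then have Ky: "real K \<le> y" unfolding K_def by linarith
    have h0: "0 \<le> h n" using y0 n1 unfolding h_def y_def[symmetric] by simp
    show ?case
    proof (cases "card \<C> = 0")
      \<comment> \<open>The logarithm of 0 has the value 0, so the claim reduces to
        \<open>0 \<le> h n\<close>.\<close>
      case True
      then show ?thesis using h0 by (simp add: \<C>_def log_def)
    next
      case False
      have small: "\<exists>\<F>. flat_cover M \<F> \<and> card \<F> \<le> K" if "M \<in> \<C>" for M
      proof -
        obtain \<F> where F: "flat_cover M \<F>" "real (card \<F>) \<le> y"
          using elim(1) \<open>M \<in> \<C>\<close> unfolding \<C>_def y_def by blast
        have "card \<F> \<le> K" using F(2) unfolding K_def by linarith
        then show ?thesis using F(1) by blast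
      qed
      let ?A = "Pow {1..n} \<times> {0..n}"
      have cA: "real (card ?A) = (real n + 1) * 2 ^ n" by (simp add: card_cartesian_product card_Pow algebra_simps)
      have "card \<C> \<le> (n + 1) * card {Z. Z \<subseteq> ?A \<and> card Z \<le> K}"
        by (rule card_with_small_flat_cover[OF _ small]) (auto simp: \<C>_def)
      then have "real (card \<C>) \<le> real ((n + 1) * card {Z. Z \<subseteq> ?A \<and> card Z \<le> K})"
        by (rule of_nat_mono)
      also have "\<dots> = (real n + 1) * real (card {Z. Z \<subseteq> ?A \<and> card Z \<le> K})"
        by (simp only: of_nat_mult of_nat_add of_nat_1)
      \<comment> \<open>The choice x = 1/n^4 makes \<open>x * card A\<close> negligible against the
        target while \<open>(1 / x) ^ K\<close> costs only 4 ln n per member.\<close>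
      also have "\<dots> \<le> (real n + 1) * (exp (1 / real n ^ 4 * real (card ?A)) * (1 / (1 / real n ^ 4)) ^ K)"
        using n1 by (intro mult_left_mono card_small_subsets_le) auto
      also have "\<dots> = (real n + 1) * (exp ((real n + 1) * 2 ^ n / real n ^ 4) * (real n ^ 4) ^ K)"
        unfolding cA by simp
      finally have "ln (real (card \<C>)) \<le> ln ((real n + 1) * (exp ((real n + 1) * 2 ^ n / real n ^ 4) * (real n ^ 4) ^ K))"
        using False by (intro ln_mono) auto
      also have "\<dots> = ln (real n + 1) + ((real n + 1) * 2 ^ n / real n ^ 4 + real K * (4 * ln (real n)))"
        using n1 by (simp add: ln_mult ln_realpow)
      also have "real K * (4 * ln (real n)) \<le> 4 * ln (real n) * y"
        using mult_right_mono[OF Ky, of "4 * ln (real n)"] n1 by (simp add: mult.commute)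
      finally have "ln (real (card \<C>)) / ln 2 \<le> h n"
        unfolding h_def y_def[symmetric] by (intro divide_right_mono) auto
      moreover have "0 \<le> ln (real (card \<C>))" using False by simp
      ultimately show ?thesis using h0 by (simp add: log_def \<C>_def)
    qed
  qed
  then have "(\<lambda>n. log 2 (real (card (excluding N \<inter> matroids_on n)))) \<in> O(h)" by (rule bigoI)
  moreover have "h \<in> O(\<lambda>n. 2 ^ n / real n powr (5/2) * (log 2 (real n))\<^sup>2)"
    unfolding h_def using a by real_asymp
  ultimately show ?thesis by (rule landau_o.big_trans)
qed

end
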